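(* Let $R=\mathbb Z[u_{s,i}^{\pm1},u_{t,j}^{\pm1}]_{1\le i\le 3,\,1\le j\le 4}$ and let $$H_{G_{10}}=\Big\langle s,t\ \Big|\ stst=tsts,\ \prod_{i=1}^3(s-u_{s,i})=\prod_{j=1}^4(t-u_{t,j})=0\Big\rangle$$ be the generic Hecke algebra (an associative unital $R$-algebra) of $G_{10}$. Let $u_1,u_2$ be the $R$-subalgebras generated by $s$ and by $t$ respectively, let $z=(st)^2$, and let $$U=\sum_{k=0}^{11}\big(z^ku_2u_1+z^ku_2st^{-1}+z^ku_2s^{-1}t+z^ku_2s^{-1}ts^{-1}\big).$$ Then $H_{G_{10}}=U$.
   Context: For subsets $X,Y$ of an $R$-algebra, $XY$ denotes the $R$-submodule spanned by the products $xy$. The generators are invertible in the algebra because the parameters are invertible in $R$. *)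

theory Defs
  imports Complex_Main "HOL-Library.Poly_Mapping" "HOL-Library.Set_Algebras"
begin

subsection \<open>The ring of Laurent polynomials\<close>

datatype param = Us1 | Us2 | Us3 | Ut1 | Ut2 | Ut3 | Ut4

text \<open>
  The Laurent polynomial ring over the integers is the group ring of the free abelian group
  of integer exponent vectors indexed by \<^typ>\<open>param\<close>; multiplication of
  \<^type>\<open>poly_mapping\<close>s is convolution.
\<close>

type_synonym laurent = "(param \<Rightarrow>\<^sub>0 int) \<Rightarrow>\<^sub>0 int"

definition indet :: "param \<Rightarrow> laurent" where
  "indet p = Poly_Mapping.single (Poly_Mapping.single p 1) 1"

definition indet_inv :: "param \<Rightarrow> laurent" where
  "indet_inv p = Poly_Mapping.single (Poly_Mapping.single p (- 1)) 1"

lemma indet_mult_inv: "indet p * indet_inv p = 1"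
  by (simp add: indet_def indet_inv_def mult_single flip: single_add)

subsection \<open>The free algebra on two generators\<close>

datatype gen = S | T

text \<open>
  Words carry the additive notation because the exponents of \<^type>\<open>poly_mapping\<close>s do; the
  (noncommutative) addition is concatenation, so \<open>free_alg\<close> is the monoid ring of the free
  monoid over the Laurent polynomials.
\<close>

datatype word = Word "gen list"

instantiation word :: monoid_add
begin

definition zero_word :: word where
  "0 = Word []"

fun plus_word :: "word \<Rightarrow> word \<Rightarrow> word" where
  "Word v + Word w = Word (v @ w)"

instance
proof
  fix a b c :: word
  show "a + b + c = a + (b + c)"
    by (cases a; cases b; cases c) simp
  show "0 + a = a" "a + 0 = a"
    by (cases a; simp add: zero_word_def)+
qed

end

type_synonym free_alg = "word \<Rightarrow>\<^sub>0 laurent"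

definition free_gen :: "gen \<Rightarrow> free_alg" where
  "free_gen g = Poly_Mapping.single (Word [g]) 1"

definition free_const :: "laurent \<Rightarrow> free_alg" where
  "free_const r = Poly_Mapping.single 0 r"

lemma free_const_simps:
  "free_const 0 = 0" "free_const 1 = 1"
  "free_const (a + b) = free_const a + free_const b"
  "free_const (a * b) = free_const a * free_const b"
  by (simp_all add: free_const_def single_add mult_single)

lemma poly_mapping_single_induct [case_names zero single add]:
  assumes "P 0" "\<And>k a. P (Poly_Mapping.single k a)" "\<And>x y. P x \<Longrightarrow> P y \<Longrightarrow> P (x + y)"
  shows "P (x :: 'a \<Rightarrow>\<^sub>0 'b :: monoid_add)"
proof (induction x rule: update_induct)
  case const
  show ?case by (fact assms(1))
next
  case (update f a b)
  have "Poly_Mapping.update a b f = f + Poly_Mapping.single a b"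
    using update(1)
    by (intro poly_mapping_eqI)
      (auto simp: lookup_update lookup_add lookup_single in_keys_iff when_def)
  with update(3) show ?case
    by (simp add: assms)
qed

lemma free_const_central: "free_const r * x = x * free_const r"
proof (induction x rule: poly_mapping_single_induct)
  case (single k a)
  show ?case by (simp add: free_const_def mult_single mult.commute)
qed (simp_all add: distrib_left distrib_right)

subsection \<open>The generic Hecke algebra\<close>

definition two_sided_ideal :: "'a :: ring_1 set \<Rightarrow> bool" where
  "two_sided_ideal I \<longleftrightarrow> 0 \<in> I \<and> (\<forall>x\<in>I. \<forall>y\<in>I. x + y \<in> I) \<and> (\<forall>x\<in>I. \<forall>a. a * x \<in> I \<and> x * a \<in> I)"

definition hecke_relators :: "free_alg set" where
  "hecke_relators =
    (let s = free_gen S; t = free_gen T; u = (\<lambda>p. free_const (indet p)) in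
      {s * t * s * t - t * s * t * s,
       (s - u Us1) * (s - u Us2) * (s - u Us3),
       (t - u Ut1) * (t - u Ut2) * (t - u Ut3) * (t - u Ut4)})"

definition hecke_ideal :: "free_alg set" where
  "hecke_ideal = two_sided_ideal hull hecke_relators"

lemma two_sided_ideal_hecke_ideal: "two_sided_ideal hecke_ideal"
  unfolding hecke_ideal_def by (rule hull_in) (auto simp: two_sided_ideal_def)

lemma hecke_ideal_relators: "x \<in> hecke_relators \<Longrightarrow> x \<in> hecke_ideal"
  unfolding hecke_ideal_def by (rule hull_inc)

lemma hecke_ideal_closed:
  shows hecke_ideal_0: "0 \<in> hecke_ideal"
    and hecke_ideal_add: "x \<in> hecke_ideal \<Longrightarrow> y \<in> hecke_ideal \<Longrightarrow> x + y \<in> hecke_ideal"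
    and hecke_ideal_mult_left: "x \<in> hecke_ideal \<Longrightarrow> a * x \<in> hecke_ideal"
    and hecke_ideal_mult_right: "x \<in> hecke_ideal \<Longrightarrow> x * a \<in> hecke_ideal"
  using two_sided_ideal_hecke_ideal by (auto simp: two_sided_ideal_def)

lemma hecke_ideal_uminus: "x \<in> hecke_ideal \<Longrightarrow> - x \<in> hecke_ideal"
  using hecke_ideal_mult_left[of x "- 1"] by simp

subsection \<open>Nontriviality\<close>

text \<open>
  Specialising every parameter and both generators to 1 gives a ring homomorphism from the free
  algebra to the integers that kills all relators, whence 0 and 1 differ in the Hecke algebra.
\<close>

definition augment :: "('a \<Rightarrow>\<^sub>0 'b :: comm_monoid_add) \<Rightarrow> 'b" where
  "augment x = Sum_any (Poly_Mapping.lookup x)"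

lemma augment_0 [simp]: "augment 0 = 0"
  by (simp add: augment_def)

lemma augment_add [simp]: "augment (x + y) = augment x + augment y"
  by (simp add: augment_def lookup_add Sum_any.distrib)

lemma augment_diff [simp]: "augment (x - y) = augment x - (augment y :: 'b :: ab_group_add)"
  by (metis add_diff_cancel augment_add diff_add_cancel)

lemma augment_single [simp]: "augment (Poly_Mapping.single k a) = a"
  by (simp add: augment_def lookup_single)

lemma augment_1 [simp]: "augment (1 :: 'a :: zero \<Rightarrow>\<^sub>0 'b :: {comm_monoid_add, zero_neq_one}) = 1"
  by (metis augment_single single_one)

lemma augment_mult [simp]:
  "augment (x * y) = augment x * augment (y :: 'a :: monoid_add \<Rightarrow>\<^sub>0 'b :: semiring_0)"
proof (induction x rule: poly_mapping_single_induct)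
  case (single k a)
  show ?case
    by (induction y rule: poly_mapping_single_induct) (simp_all add: mult_single distrib_left)
qed (simp_all add: distrib_right)

lemma one_notin_hecke_ideal: "1 \<notin> hecke_ideal"
proof -
  have "two_sided_ideal {x :: free_alg. augment (augment x) = 0}"
    by (simp add: two_sided_ideal_def)
  moreover have "hecke_relators \<subseteq> {x. augment (augment x) = 0}"
    by (auto simp: hecke_relators_def Let_def free_gen_def free_const_def indet_def)
  ultimately have "hecke_ideal \<subseteq> {x. augment (augment x) = 0}"
    unfolding hecke_ideal_def by (intro hull_minimal)
  then show ?thesis
    by auto
qed

subsection \<open>The quotient ring\<close>

quotient_type hecke = free_alg / "\<lambda>x y. x - y \<in> hecke_ideal"
proof (rule equivpI)
  show "reflp (\<lambda>x y. x - y \<in> hecke_ideal)"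
    by (simp add: reflp_def hecke_ideal_0)
  show "symp (\<lambda>x y. x - y \<in> hecke_ideal)"
    by (metis (lifting) sympI hecke_ideal_uminus minus_diff_eq)
  show "transp (\<lambda>x y. x - y \<in> hecke_ideal)"
  proof (rule transpI)
    fix x y z :: free_alg
    assume "x - y \<in> hecke_ideal" "y - z \<in> hecke_ideal"
    then have "(x - y) + (y - z) \<in> hecke_ideal"
      by (rule hecke_ideal_add)
    then show "x - z \<in> hecke_ideal"
      by simp
  qed
qed

instantiation hecke :: ring_1
begin

lift_definition zero_hecke :: hecke is 0 .
lift_definition one_hecke :: hecke is 1 .

lift_definition plus_hecke :: "hecke \<Rightarrow> hecke \<Rightarrow> hecke" is "(+)"
  by (metis add_diff_add hecke_ideal_add)

lift_definition uminus_hecke :: "hecke \<Rightarrow> hecke" is uminus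
  by (metis hecke_ideal_uminus minus_diff_eq minus_diff_minus)

lift_definition minus_hecke :: "hecke \<Rightarrow> hecke \<Rightarrow> hecke" is "(-)"
proof -
  fix a b c d :: free_alg
  assume *: "a - b \<in> hecke_ideal" "c - d \<in> hecke_ideal"
  have "a - c - (b - d) = (a - b) + - (c - d)"
    by simp
  then show "a - c - (b - d) \<in> hecke_ideal"
    using * by (metis hecke_ideal_add hecke_ideal_uminus)
qed

lift_definition times_hecke :: "hecke \<Rightarrow> hecke \<Rightarrow> hecke" is "(*)"
proof -
  fix a b c d :: free_alg
  assume *: "a - b \<in> hecke_ideal" "c - d \<in> hecke_ideal"
  have "a * c - b * d = (a - b) * c + b * (c - d)"
    by (simp add: algebra_simps)
  then show "a * c - b * d \<in> hecke_ideal"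
    using * by (simp add: hecke_ideal_add hecke_ideal_mult_left hecke_ideal_mult_right)
qed

instance
proof
  fix a b c :: hecke
  show "a * b * c = a * (b * c)"
    by transfer (simp add: mult.assoc hecke_ideal_0)
  show "1 * a = a" "a * 1 = a" "0 + a = a" "- a + a = 0"
    by (transfer, simp add: hecke_ideal_0)+
  show "a + b + c = a + (b + c)" "a + b = b + a"
    by (transfer, simp add: ac_simps hecke_ideal_0)+
  show "a - b = a + - b"
    by transfer (simp add: hecke_ideal_0)
  show "(a + b) * c = a * c + b * c" "a * (b + c) = a * b + a * c"
    by (transfer, simp add: distrib_left distrib_right hecke_ideal_0)+
  show "(0 :: hecke) \<noteq> 1"
    by transfer (use one_notin_hecke_ideal hecke_ideal_uminus in force)
qed

end

lift_definition hecke_const :: "laurent \<Rightarrow> hecke" is free_const .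

definition hecke_scale :: "laurent \<Rightarrow> hecke \<Rightarrow> hecke" where
  "hecke_scale r x = hecke_const r * x"

lemma hecke_const_simps:
  "hecke_const 0 = 0" "hecke_const 1 = 1"
  "hecke_const (a + b) = hecke_const a + hecke_const b"
  "hecke_const (a * b) = hecke_const a * hecke_const b"
  subgoal by transfer (simp add: free_const_simps hecke_ideal_0)
  subgoal by transfer (simp add: free_const_simps hecke_ideal_0)
  subgoal by transfer (simp add: free_const_simps hecke_ideal_0)
  subgoal by transfer (simp add: free_const_simps hecke_ideal_0)
  done

lemma hecke_const_central: "hecke_const r * x = x * hecke_const r"
  by transfer (simp add: free_const_central hecke_ideal_0)

global_interpretation hecke: module hecke_scale
  by standard (simp_all add: hecke_scale_def hecke_const_simps algebra_simps)

lemma hecke_scale_mult: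
  "hecke_scale r x * y = hecke_scale r (x * y)" "x * hecke_scale r y = hecke_scale r (x * y)"
  by (simp_all add: hecke_scale_def mult.assoc)
    (simp add: hecke_const_central mult.assoc)

lift_definition hecke_s :: hecke is "free_gen S" .
lift_definition hecke_t :: hecke is "free_gen T" .

lemma hecke_braid: "hecke_s * hecke_t * hecke_s * hecke_t = hecke_t * hecke_s * hecke_t * hecke_s"
  by transfer (rule hecke_ideal_relators, simp add: hecke_relators_def Let_def)

lemma hecke_s_cubic:
  "(hecke_s - hecke_const (indet Us1)) * (hecke_s - hecke_const (indet Us2)) *
   (hecke_s - hecke_const (indet Us3)) = 0"
  by transfer (rule hecke_ideal_relators, simp add: hecke_relators_def Let_def)

lemma hecke_t_quartic:
  "(hecke_t - hecke_const (indet Ut1)) * (hecke_t - hecke_const (indet Ut2)) *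
   (hecke_t - hecke_const (indet Ut3)) * (hecke_t - hecke_const (indet Ut4)) = 0"
  by transfer (rule hecke_ideal_relators, simp add: hecke_relators_def Let_def)

subsection \<open>Inverses, subalgebras and products of subsets\<close>

text \<open>
  \<open>alg_inverse x\<close> is only meaningful if \<open>x\<close> has a two-sided inverse; that the generators do is
  proved below.
\<close>

definition alg_inverse :: "'a :: monoid_mult \<Rightarrow> 'a" where
  "alg_inverse x = (THE y. x * y = 1 \<and> y * x = 1)"

lemma alg_inverse_eqI:
  assumes "x * y = 1" "y * x = 1"
  shows "alg_inverse x = y"
  unfolding alg_inverse_def
proof (rule the_equality)
  fix y' assume "x * y' = 1 \<and> y' * x = 1"
  then show "y' = y"
    using assms by (metis mult.assoc mult_1_left mult_1_right)
qed (use assms in simp)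

lemma hecke_prod_linear:
  "\<exists>q. prod_list (map (\<lambda>p. x - hecke_const (indet p)) ps) =
        x * q + hecke_const (prod_list (map (\<lambda>p. - indet p) ps)) \<and> x * q = q * x"
proof (induction ps)
  case Nil
  show ?case by (rule exI[of _ 0]) (simp add: hecke_const_simps)
next
  case (Cons p ps)
  let ?c = "hecke_const (indet p)"
  let ?d = "hecke_const (prod_list (map (\<lambda>p. - indet p) ps))"
  obtain q where q: "prod_list (map (\<lambda>p. x - hecke_const (indet p)) ps) = x * q + ?d"
      "x * q = q * x"
    using Cons by blast
  have neg: "hecke_const (- r) = - hecke_const r" for r
    by (metis add_eq_0_iff hecke_const_simps(1,3) add.right_inverse)
  let ?q = "x * q + ?d - ?c * q"
  have cx: "?c * (x * q) = x * (?c * q)" "?c * q * x = ?c * (q * x)"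
    by (metis hecke_const_central mult.assoc)+
  have "prod_list (map (\<lambda>p. x - hecke_const (indet p)) (p # ps)) = (x - ?c) * (x * q + ?d)"
    by (simp add: q)
  also have "\<dots> = x * ?q + hecke_const (prod_list (map (\<lambda>p. - indet p) (p # ps)))"
    by (simp add: algebra_simps neg hecke_const_simps cx)
  finally have 1: "prod_list (map (\<lambda>p. x - hecke_const (indet p)) (p # ps)) =
      x * ?q + hecke_const (prod_list (map (\<lambda>p. - indet p) (p # ps)))" .
  have "x * ?q = x * (x * q) + x * ?d - x * (?c * q)"
    by (simp add: algebra_simps)
  also have "\<dots> = x * q * x + ?d * x - ?c * q * x"
  proof -
    have "x * (x * q) = x * q * x"
      by (subst q(2)) (simp only: mult.assoc)
    moreover have "x * ?d = ?d * x"
      by (rule hecke_const_central[symmetric])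
    moreover have "x * (?c * q) = ?c * q * x"
      by (simp only: cx(1)[symmetric] q(2) cx(2))
    ultimately show ?thesis
      by (simp only:)
  qed
  also have "\<dots> = ?q * x"
    by (simp add: algebra_simps)
  finally show ?case
    using 1 by blast
qed

lemma prod_list_indet_unit:
  "prod_list (map (\<lambda>p. - indet p) ps) * prod_list (map (\<lambda>p. - indet_inv p) ps) = 1"
proof (induction ps)
  case (Cons p ps)
  have "indet p * x * (indet_inv p * y) = x * y" for x y
  proof -
    have "indet p * x * (indet_inv p * y) = (indet p * indet_inv p) * (x * y)"
      by (simp only: ac_simps)
    then show ?thesis
      by (simp add: indet_mult_inv)
  qed
  then show ?case
    using Cons by simp
qed simp

lemma hecke_root_unit:
  assumes "prod_list (map (\<lambda>p. x - hecke_const (indet p)) ps) = 0"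
  shows "x * alg_inverse x = 1" "alg_inverse x * x = 1"
proof -
  let ?d = "prod_list (map (\<lambda>p. - indet p) ps)"
  let ?e = "prod_list (map (\<lambda>p. - indet_inv p) ps)"
  obtain q where q: "x * q + hecke_const ?d = 0" "x * q = q * x"
    using hecke_prod_linear[of x ps] assms by auto
  have e: "x * q * hecke_const ?e = - 1"
  proof -
    have "x * q * hecke_const ?e = - (hecke_const ?d * hecke_const ?e)"
      using q(1) by (simp add: eq_neg_iff_add_eq_0 flip: distrib_right)
    then show ?thesis
      by (simp add: prod_list_indet_unit hecke_const_simps flip: hecke_const_simps(4))
  qed
  let ?y = "- (q * hecke_const ?e)"
  have 1: "x * ?y = 1"
    using e by (simp add: mult.assoc)
  have "?y * x = - (q * x * hecke_const ?e)"
    by (simp add: mult.assoc hecke_const_central[of _ x])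
  then have 2: "?y * x = 1"
    using e q(2) by simp
  show "x * alg_inverse x = 1" "alg_inverse x * x = 1"
    using 1 2 alg_inverse_eqI[OF 1 2] by simp_all
qed

lemma hecke_s_inverse: "hecke_s * alg_inverse hecke_s = 1" "alg_inverse hecke_s * hecke_s = 1"
  using hecke_root_unit[of hecke_s "[Us1, Us2, Us3]"] hecke_s_cubic by (simp_all add: mult.assoc)

lemma hecke_t_inverse: "hecke_t * alg_inverse hecke_t = 1" "alg_inverse hecke_t * hecke_t = 1"
  using hecke_root_unit[of hecke_t "[Ut1, Ut2, Ut3, Ut4]"] hecke_t_quartic
  by (simp_all add: mult.assoc)

definition hecke_subalgebra :: "hecke set \<Rightarrow> bool" where
  "hecke_subalgebra B \<longleftrightarrow> hecke.subspace B \<and> 1 \<in> B \<and> (\<forall>x\<in>B. \<forall>y\<in>B. x * y \<in> B)"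

definition hecke_u1 :: "hecke set" where
  "hecke_u1 = hecke_subalgebra hull {hecke_s}"

definition hecke_u2 :: "hecke set" where
  "hecke_u2 = hecke_subalgebra hull {hecke_t}"

text \<open>
  On the right-hand side, \<open>*\<close> is the elementwise product of sets from
  \<^theory>\<open>HOL-Library.Set_Algebras\<close>.
\<close>

definition span_mult :: "hecke set \<Rightarrow> hecke set \<Rightarrow> hecke set"  (infixl "\<odot>" 75) where
  "X \<odot> Y = hecke.span (X * Y)"

definition hecke_z :: hecke where
  "hecke_z = (hecke_s * hecke_t) ^ 2"

text \<open>
  The sum of submodules is the elementwise sum of sets (again from
  \<^theory>\<open>HOL-Library.Set_Algebras\<close>); elements occurring as factors of a product of
  subsets are read as singletons.
\<close>

definition hecke_U :: "hecke set" where
  "hecke_U =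
    (let s = hecke_s; t = hecke_t; s' = alg_inverse s; t' = alg_inverse t; z = hecke_z in
      \<Sum>k = 0..11.
          {z ^ k} \<odot> hecke_u2 \<odot> hecke_u1
        + {z ^ k} \<odot> hecke_u2 \<odot> {s * t'}
        + {z ^ k} \<odot> hecke_u2 \<odot> {s' * t}
        + {z ^ k} \<odot> hecke_u2 \<odot> {s' * t * s'})"

end

theory Submission
  imports Defs
begin

text \<open>
  By the cubic relation, \<open>y s^i y'\<close> lies in a submodule for all \<open>i\<close> as soon as it does for three
  consecutive \<open>i\<close>; by the quartic relation the same holds for \<open>y t^i y'\<close> with four consecutive \<open>i\<close>.
  Together with invariance under left multiplication by \<open>t\<close> and the identities of the braid
  group, these two rules suffice to derive, from the spanning elements of \<open>U\<close>, that \<open>U\<close> is a right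
  ideal. It contains 1, so it is everything. The delicate point is the range of the exponent \<open>k\<close>
  of \<open>z\<close>: a rule usually shifts \<open>k\<close>, so a membership is first obtained for \<open>k\<close> in the middle of
  \<open>{0..11}\<close> and only later, by other routes, at the ends.
\<close>

section \<open>Integer powers\<close>

definition ipow :: "'a :: monoid_mult \<Rightarrow> int \<Rightarrow> 'a" where
  "ipow a n = (if 0 \<le> n then a ^ nat n else alg_inverse a ^ nat (- n))"

lemma ipow_simps [simp]: "ipow a 0 = 1" "ipow a 1 = a" "ipow a (- 1) = alg_inverse a"
  by (simp_all add: ipow_def)

lemma ipow_of_nat [simp]: "ipow a (int n) = a ^ n"
  by (simp add: ipow_def)

text \<open>\<open>alg_inverse\<close> is a definite description, so these two equations hold
  exactly when \<open>a\<close> has a two-sided inverse.\<close>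

definition unit_elem :: "'a :: monoid_mult \<Rightarrow> bool" where
  "unit_elem a \<longleftrightarrow> a * alg_inverse a = 1 \<and> alg_inverse a * a = 1"

lemma unit_elem_mult:
  assumes "unit_elem a" "unit_elem b"
  shows "unit_elem (a * b)"
proof -
  have "a * b * (alg_inverse b * alg_inverse a) = 1" "alg_inverse b * alg_inverse a * (a * b) = 1"
    using assms by (metis mult.assoc mult_1_left unit_elem_def)+
  with alg_inverse_eqI[OF this] show ?thesis
    by (simp add: unit_elem_def)
qed

lemma ipow_plus_1:
  assumes "unit_elem a"
  shows "ipow a (n + 1) = ipow a n * a"
proof (cases "0 \<le> n")
  case True
  then have "nat (n + 1) = Suc (nat n)"
    by simp
  with True show ?thesis
    by (simp add: ipow_def power_commutes)
next
  case False
  define m where "m = nat (- n - 1)"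
  have "nat (- n) = Suc m" "nat (- (n + 1)) = m"
    using False by (simp_all add: m_def)
  moreover have "alg_inverse a ^ Suc m * a = alg_inverse a ^ m"
    using assms by (simp add: power_Suc2 mult.assoc unit_elem_def del: power_Suc)
  \<comment> \<open>At \<open>n = -1\<close> the exponent \<open>n + 1\<close> already falls into
    the nonnegative branch of \<open>ipow\<close>.\<close>
  ultimately show ?thesis
    using False by (cases "n = -1") (auto simp: ipow_def m_def)
qed

lemma ipow_minus_1:
  assumes "unit_elem a"
  shows "ipow a (n - 1) = ipow a n * alg_inverse a"
  using ipow_plus_1[OF assms, of "n - 1"] assms by (simp add: mult.assoc unit_elem_def)

lemma ipow_add:
  assumes "unit_elem a"
  shows "ipow a (m + n) = ipow a m * ipow a n"
proof (induction n rule: int_induct[where k = 0])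
  case (step1 i)
  then show ?case
    by (metis add.assoc assms ipow_plus_1 mult.assoc)
next
  case (step2 i)
  then show ?case
    by (metis add_diff_eq assms ipow_minus_1 mult.assoc)
qed simp

text \<open>Multiplying \<open>a * c = c * a\<close> by the inverse on both sides transfers the
  commutation to the inverse.\<close>

lemma ipow_commute:
  assumes "unit_elem a" "a * c = c * a"
  shows "ipow a n * c = c * ipow a n"
proof -
  have "alg_inverse a * c = alg_inverse a * (c * a) * alg_inverse a"
    using assms(1) by (simp add: mult.assoc unit_elem_def)
  also have "\<dots> = c * alg_inverse a"
    unfolding assms(2)[symmetric] using assms(1) by (simp add: unit_elem_def flip: mult.assoc)
  finally have "alg_inverse a * c = c * alg_inverse a" .
  then show ?thesis
    unfolding ipow_def by (simp add: power_commuting_commutes assms)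
qed

section \<open>Generators of the Hecke algebra\<close>

abbreviation sp :: "int \<Rightarrow> hecke" where "sp \<equiv> ipow hecke_s"
abbreviation tp :: "int \<Rightarrow> hecke" where "tp \<equiv> ipow hecke_t"
abbreviation zp :: "int \<Rightarrow> hecke" where "zp \<equiv> ipow hecke_z"
abbreviation hx :: hecke where "hx \<equiv> hecke_s * hecke_t"

lemma unit_s: "unit_elem hecke_s" and unit_t: "unit_elem hecke_t"
  by (simp_all add: unit_elem_def hecke_s_inverse hecke_t_inverse)

lemma unit_z: "unit_elem hecke_z"
  by (simp add: hecke_z_def power2_eq_square unit_elem_mult unit_s unit_t)

lemmas sp_add = ipow_add[OF unit_s]
lemmas tp_add = ipow_add[OF unit_t]
lemmas zp_add = ipow_add[OF unit_z]

lemma hx_hx: "hx * hx = hecke_z"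
  by (simp add: hecke_z_def power2_eq_square)

text \<open>Words span the free algebra over the Laurent polynomials, and the quotient map is onto.
  This is the induction principle for the algebra, applied to the centralizer of
  \<open>hecke_z\<close> and to the right multipliers of \<open>hecke_U\<close>.\<close>

lemma hecke_generated:
  assumes B: "hecke_subalgebra B" and "hecke_s \<in> B" "hecke_t \<in> B"
  shows "x \<in> B"
proof -
  have sub: "hecke.subspace B" and one: "1 \<in> B" and mult: "\<And>x y. x \<in> B \<Longrightarrow> y \<in> B \<Longrightarrow> x * y \<in> B"
    using B by (auto simp: hecke_subalgebra_def)
  have word: "abs_hecke (Poly_Mapping.single (Word ws) 1) \<in> B" for ws
  proof (induction ws)
    case Nil
    then show ?case
      using one by (simp add: one_hecke_def flip: zero_word_def single_one)
  next
    case (Cons g ws)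
    have "abs_hecke (Poly_Mapping.single (Word (g # ws)) 1) =
        abs_hecke (free_gen g) * abs_hecke (Poly_Mapping.single (Word ws) 1)"
      by (simp add: times_hecke.abs_eq free_gen_def mult_single)
    moreover have "abs_hecke (free_gen g) \<in> B"
      using assms(2,3) by (cases g) (simp_all add: hecke_s_def hecke_t_def)
    ultimately show ?case
      using Cons mult by simp
  qed
  have "abs_hecke f \<in> B" for f
  proof (induction f rule: poly_mapping_single_induct)
    case zero
    show ?case
      using hecke.subspace_0[OF sub] by (simp add: zero_hecke_def)
  next
    case (single k a)
    obtain ws where k: "k = Word ws"
      by (cases k)
    have "abs_hecke (Poly_Mapping.single k a) =
        hecke_scale a (abs_hecke (Poly_Mapping.single (Word ws) 1))"
      by (simp add: k hecke_scale_def hecke_const.abs_eq times_hecke.abs_eq free_const_def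
          mult_single)
    then show ?case
      using hecke.subspace_scale[OF sub word] by simp
  next
    case (add f g)
    then show ?case
      using hecke.subspace_add[OF sub] by (simp flip: plus_hecke.abs_eq)
  qed
  then show ?thesis
    by (metis Quotient_abs_rep[OF Quotient_hecke])
qed

text \<open>The centralizer of \<open>z\<close> is a subalgebra, and it contains both generators
  because \<open>z = stst = tsts\<close>.\<close>

lemma z_central: "hecke_z * x = x * hecke_z"
proof -
  have "hecke_subalgebra {x. hecke_z * x = x * hecke_z}"
    unfolding hecke_subalgebra_def hecke.subspace_def
    by (auto simp: hecke_scale_mult algebra_simps) (metis mult.assoc)
  moreover have "hecke_z * hecke_s = hecke_s * hecke_z" "hecke_z * hecke_t = hecke_t * hecke_z"
    unfolding hecke_z_def power2_eq_square using hecke_braid by (metis mult.assoc)+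
  ultimately show ?thesis
    using hecke_generated[of "{x. hecke_z * x = x * hecke_z}"] by blast
qed

lemma zp_central: "zp k * x = x * zp k"
  by (rule ipow_commute[OF unit_z z_central])

text \<open>The constant coefficient below is a unit, so the relation can be read in both directions.\<close>

lemma hecke_prod_expand:
  "\<exists>e. prod_list (map (\<lambda>p. x - hecke_const (indet p)) ps) =
      (\<Sum>j\<le>length ps. hecke_const (e j) * x ^ j) \<and>
    e (length ps) = 1 \<and> e 0 = prod_list (map (\<lambda>p. - indet p) ps)"
proof (induction ps)
  case Nil
  show ?case
    by (rule exI[of _ "\<lambda>_. 1"]) (simp add: hecke_const_simps)
next
  case (Cons p ps)
  then obtain e where e: "prod_list (map (\<lambda>p. x - hecke_const (indet p)) ps) =
      (\<Sum>j\<le>length ps. hecke_const (e j) * x ^ j)" "e (length ps) = 1"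
      "e 0 = prod_list (map (\<lambda>p. - indet p) ps)"
    by blast
  define n where "n = length ps"
  have neg: "hecke_const (- r) = - hecke_const r" for r
    by (metis add_eq_0_iff hecke_const_simps(1,3) add.right_inverse)
  have const: "x * (hecke_const r * y) = hecke_const r * (x * y)" for r y
    by (metis hecke_const_central mult.assoc)
  define e' where "e' j = (if j = 0 then 0 else e (j - 1)) - (if j \<le> n then indet p * e j else 0)"
    for j
  have "(\<Sum>j\<le>Suc n. hecke_const (e' j) * x ^ j) =
      (\<Sum>j\<le>Suc n. hecke_const (if j = 0 then 0 else e (j - 1)) * x ^ j) -
      (\<Sum>j\<le>Suc n. hecke_const (if j \<le> n then indet p * e j else 0) * x ^ j)"
    unfolding e'_def diff_conv_add_uminus hecke_const_simps neg
    by (simp only: sum.distrib sum_negf distrib_right mult_minus_left)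
  also have "\<dots> = x * (\<Sum>j\<le>n. hecke_const (e j) * x ^ j) -
      hecke_const (indet p) * (\<Sum>j\<le>n. hecke_const (e j) * x ^ j)"
  proof -
    have "(\<Sum>j\<le>Suc n. hecke_const (if j = 0 then 0 else e (j - 1)) * x ^ j) =
        x * (\<Sum>j\<le>n. hecke_const (e j) * x ^ j)"
      by (subst sum.atMost_Suc_shift) (simp add: hecke_const_simps sum_distrib_left const)
    moreover have "(\<Sum>j\<le>Suc n. hecke_const (if j \<le> n then indet p * e j else 0) * x ^ j) =
        hecke_const (indet p) * (\<Sum>j\<le>n. hecke_const (e j) * x ^ j)"
      by (simp add: hecke_const_simps sum_distrib_left mult.assoc)
    ultimately show ?thesis
      by simp
  qed
  finally have "prod_list (map (\<lambda>p. x - hecke_const (indet p)) (p # ps)) =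
      (\<Sum>j\<le>length (p # ps). hecke_const (e' j) * x ^ j)"
    by (simp add: e(1) left_diff_distrib n_def)
  moreover have "e' (length (p # ps)) = 1" "e' 0 = prod_list (map (\<lambda>p. - indet p) (p # ps))"
    using e(2,3) by (simp_all add: e'_def n_def)
  ultimately show ?case
    by blast
qed

text \<open>Multiplying the polynomial relation by \<open>x^i\<close> gives a linear recurrence for
  the elements \<open>A i\<close>. Its leading coefficient 1 allows the step upwards, its invertible
  constant coefficient the step downwards.\<close>

lemma consecutive_powers:
  assumes root: "prod_list (map (\<lambda>p. x - hecke_const (indet p)) ps) = 0"
    and M: "hecke.subspace M"
    and powers: "\<And>j. j < length ps \<Longrightarrow> y * ipow x (a + int j) * y' \<in> M"
  shows "y * ipow x b * y' \<in> M"
proof -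
  define n where "n = length ps"
  define A where "A i = y * ipow x i * y'" for i
  have x: "unit_elem x"
    using hecke_root_unit[OF root] by (simp add: unit_elem_def)
  obtain e where e: "(\<Sum>j\<le>n. hecke_const (e j) * x ^ j) = 0"
      "e n = 1" "e 0 = prod_list (map (\<lambda>p. - indet p) ps)"
    using hecke_prod_expand[of x ps] root by (auto simp: n_def)
  have rel: "(\<Sum>j\<le>n. hecke_scale (e j) (A (i + int j))) = 0" for i
  proof -
    have "(\<Sum>j\<le>n. hecke_scale (e j) (A (i + int j))) =
        y * ipow x i * (\<Sum>j\<le>n. hecke_const (e j) * x ^ j) * y'"
      unfolding sum_distrib_left sum_distrib_right
    proof (rule sum.cong)
      fix j
      have "y * ipow x i * (hecke_const (e j) * x ^ j) * y' =
          hecke_const (e j) * (y * (ipow x i * x ^ j) * y')"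
        by (metis hecke_const_central mult.assoc)
      then show "hecke_scale (e j) (A (i + int j)) =
          y * ipow x i * (hecke_const (e j) * x ^ j) * y'"
        by (simp add: hecke_scale_def A_def ipow_add[OF x])
    qed simp
    then show ?thesis
      by (simp add: e(1))
  qed
  have up: "A (i + int n) \<in> M" if "\<And>j. j < n \<Longrightarrow> A (i + int j) \<in> M" for i
  proof -
    have "(\<Sum>j<n. hecke_scale (e j) (A (i + int j))) + A (i + int n) = 0"
      using rel[of i] by (simp add: e(2) lessThan_Suc_atMost[symmetric])
    then have "A (i + int n) = - (\<Sum>j<n. hecke_scale (e j) (A (i + int j)))"
      by (simp add: eq_neg_iff_add_eq_0 add.commute)
    also have "\<dots> \<in> M"
      using that by (intro hecke.subspace_neg hecke.subspace_sum hecke.subspace_scale M) simp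
    finally show ?thesis .
  qed
  have down: "A i \<in> M" if "\<And>j. j < n \<Longrightarrow> A (i + 1 + int j) \<in> M" for i
  proof -
    \<comment> \<open>The inverse of the constant coefficient \<open>e 0\<close>.\<close>
    let ?e' = "prod_list (map (\<lambda>p. - indet_inv p) ps)"
    have "(\<Sum>j\<le>n. hecke_scale (e j) (A (i + int j))) =
        hecke_scale (e 0) (A i) + (\<Sum>j<n. hecke_scale (e (Suc j)) (A (i + 1 + int j)))"
      by (simp add: sum.atMost_shift algebra_simps)
    then have "hecke_scale (e 0) (A i) = - (\<Sum>j<n. hecke_scale (e (Suc j)) (A (i + 1 + int j)))"
      using rel[of i] by (simp add: eq_neg_iff_add_eq_0)
    also have "\<dots> \<in> M"
      using that by (intro hecke.subspace_neg hecke.subspace_sum hecke.subspace_scale M) simp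
    finally have "hecke_scale ?e' (hecke_scale (e 0) (A i)) \<in> M"
      by (rule hecke.subspace_scale[OF M])
    moreover have "?e' * e 0 = 1"
      by (simp add: e(3) prod_list_indet_unit mult.commute)
    ultimately show ?thesis
      by simp
  qed
  \<comment> \<open>The window of \<open>n\<close> consecutive indices slides by one in either
    direction.\<close>
  have "\<forall>j<n. A (c + int j) \<in> M" for c
  proof (induction c rule: int_induct[where k = a])
    case base
    then show ?case
      using powers by (simp add: A_def n_def)
  next
    case (step1 i)
    show ?case
    proof (intro allI impI)
      fix j assume "j < n"
      show "A (i + 1 + int j) \<in> M"
      proof (cases "Suc j = n")
        case True
        then have "i + 1 + int j = i + int n"
          by simp
        then show ?thesis
          using up[of i] step1(2) by (simp only: simp_thms)
      next
        case False
        with \<open>j < n\<close> have "A (i + int (Suc j)) \<in> M"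
          using step1(2) by (simp del: of_nat_Suc)
        moreover have "i + int (Suc j) = i + 1 + int j"
          by simp
        ultimately show ?thesis
          by (simp only:)
      qed
    qed
  next
    case (step2 i)
    show ?case
    proof (intro allI impI)
      fix j assume "j < n"
      show "A (i - 1 + int j) \<in> M"
      proof (cases j)
        case 0
        with down[of "i - 1"] step2(2) show ?thesis
          by simp
      next
        case (Suc j')
        with \<open>j < n\<close> have "A (i + int j') \<in> M"
          using step2(2) by simp
        then show ?thesis
          by (simp add: Suc)
      qed
    qed
  qed
  \<comment> \<open>For empty \<open>ps\<close> there is no index below \<open>n\<close> and
    \<open>up\<close> gives the claim; otherwise it is the member \<open>j = 0\<close>.\<close>
  from this[of b] up[of b] show ?thesis
    unfolding A_def by (cases "n = 0") force+
qed

lemma consecutive_sp: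
  assumes "hecke.subspace M"
    and "y * sp a * y' \<in> M" "y * sp (a + 1) * y' \<in> M" "y * sp (a + 2) * y' \<in> M"
  shows "y * sp b * y' \<in> M"
proof (rule consecutive_powers[of hecke_s "[Us1, Us2, Us3]" M y a])
  fix j assume "j < length [Us1, Us2, Us3]"
  then have "j = 0 \<or> j = 1 \<or> j = 2"
    by auto
  then show "y * sp (a + int j) * y' \<in> M"
    using assms(2-) by auto
qed (use hecke_s_cubic assms(1) in \<open>simp_all add: mult.assoc\<close>)

lemma consecutive_tp:
  assumes "hecke.subspace M"
    and "y * tp a * y' \<in> M" "y * tp (a + 1) * y' \<in> M" "y * tp (a + 2) * y' \<in> M"
      "y * tp (a + 3) * y' \<in> M"
  shows "y * tp b * y' \<in> M"
proof (rule consecutive_powers[of hecke_t "[Ut1, Ut2, Ut3, Ut4]" M y a])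
  fix j assume "j < length [Ut1, Ut2, Ut3, Ut4]"
  then have "j = 0 \<or> j = 1 \<or> j = 2 \<or> j = 3"
    by auto
  then show "y * tp (a + int j) * y' \<in> M"
    using assms(2-) by auto
qed (use hecke_t_quartic assms(1) in \<open>simp_all add: mult.assoc\<close>)

section \<open>The subalgebras generated by \<open>s\<close> and by \<open>t\<close>\<close>

lemma hecke_subalgebra_u1: "hecke_subalgebra hecke_u1"
  and hecke_subalgebra_u2: "hecke_subalgebra hecke_u2"
proof -
  have Inter: "hecke_subalgebra (\<Inter>T)" if "\<forall>B\<in>T. hecke_subalgebra B" for T
  proof -
    have "hecke.subspace (\<Inter>T)"
      using that by (intro hecke.subspace_Inter) (simp add: hecke_subalgebra_def)
    then show ?thesis
      using that by (simp add: hecke_subalgebra_def)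
  qed
  show "hecke_subalgebra hecke_u1" "hecke_subalgebra hecke_u2"
    unfolding hecke_u1_def hecke_u2_def using hull_in[of hecke_subalgebra, OF Inter] by simp_all
qed

lemma power_in_hecke_subalgebra: "hecke_subalgebra B \<Longrightarrow> x \<in> B \<Longrightarrow> x ^ n \<in> B"
  by (induction n) (auto simp: hecke_subalgebra_def)

text \<open>Closure under products yields only nonnegative powers; the negative ones follow from the
  powers 0, 1, 2 by the cubic relation.\<close>

lemma sp_in_u1: "sp j \<in> hecke_u1"
proof -
  have "sp (0 + int i) \<in> hecke_u1" for i
    using power_in_hecke_subalgebra[OF hecke_subalgebra_u1] by (simp add: hecke_u1_def hull_inc)
  from this[of 0] this[of 1] this[of 2] show ?thesis
    using consecutive_sp[of hecke_u1 1 0 1 j] hecke_subalgebra_u1 by (simp add: hecke_subalgebra_def)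
qed

lemma tp_in_u2: "tp j \<in> hecke_u2"
proof -
  have "tp (0 + int i) \<in> hecke_u2" for i
    using power_in_hecke_subalgebra[OF hecke_subalgebra_u2] by (simp add: hecke_u2_def hull_inc)
  from this[of 0] this[of 1] this[of 2] this[of 3] show ?thesis
    using consecutive_tp[of hecke_u2 1 0 1 j] hecke_subalgebra_u2 by (simp add: hecke_subalgebra_def)
qed

lemma u2_subset:
  assumes "hecke_subalgebra B" "hecke_t \<in> B"
  shows "hecke_u2 \<subseteq> B"
  unfolding hecke_u2_def using assms by (simp add: hull_minimal)

text \<open>Allows linear conditions on \<open>hecke_u1\<close> to be tested on powers of
  \<open>s\<close>. The span is closed under products by bilinearity and
  \<open>sp_add\<close>.\<close>

lemma u1_eq_span: "hecke_u1 = hecke.span (range sp)"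
proof
  let ?B = "hecke.span (range sp)"
  have mult: "x * y \<in> ?B" if x: "x \<in> ?B" and y: "y \<in> ?B" for x y
    using x
  proof (induction rule: hecke.span_induct)
    case base
    show ?case
      by (auto simp: hecke.subspace_def distrib_right hecke.span_zero hecke.span_add
          hecke.span_scale hecke_scale_mult)
  next
    case (step x)
    then obtain i where x: "x = sp i"
      by blast
    from y show ?case
    proof (induction rule: hecke.span_induct)
      case base
      show ?case
        by (auto simp: hecke.subspace_def distrib_left hecke.span_zero hecke.span_add
            hecke.span_scale hecke_scale_mult)
    next
      case (step y)
      then show ?case
        by (auto simp: x hecke.span_base simp flip: sp_add)
    qed
  qed
  have "sp 0 \<in> ?B" "sp 1 \<in> ?B"
    by (rule hecke.span_base, rule rangeI)+
  with mult have "hecke_subalgebra ?B"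
    by (simp add: hecke_subalgebra_def)
  then show "hecke_u1 \<subseteq> ?B"
    unfolding hecke_u1_def using \<open>sp 1 \<in> ?B\<close> by (intro hull_minimal) simp_all
  show "?B \<subseteq> hecke_u1"
    using sp_in_u1 hecke_subalgebra_u1
    by (intro hecke.span_minimal) (auto simp: hecke_subalgebra_def)
qed

section \<open>The submodule \<open>U\<close>\<close>

text \<open>These are the left \<open>hecke_u2\<close>-submodules; stability under the generator
  suffices by \<open>t_closed_u2\<close>.\<close>

definition t_closed :: "hecke set \<Rightarrow> bool" where
  "t_closed M \<longleftrightarrow> hecke.subspace M \<and> (\<forall>y\<in>M. hecke_t * y \<in> M)"

text \<open>The elements mapping \<open>M\<close> into itself by left multiplication form a
  subalgebra containing \<open>hecke_t\<close>.\<close>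

lemma t_closed_u2:
  assumes "t_closed M" "a \<in> hecke_u2" "y \<in> M"
  shows "a * y \<in> M"
proof -
  have "hecke_subalgebra {a. \<forall>y\<in>M. a * y \<in> M}"
    using assms(1) unfolding t_closed_def hecke_subalgebra_def hecke.subspace_def
    by (auto simp: distrib_right hecke_scale_mult mult.assoc)
  then have "hecke_u2 \<subseteq> {a. \<forall>y\<in>M. a * y \<in> M}"
    using assms(1) by (intro u2_subset) (simp_all add: t_closed_def)
  with assms show ?thesis
    by blast
qed

lemma span_mult_base: "x \<in> X \<Longrightarrow> y \<in> Y \<Longrightarrow> x * y \<in> X \<odot> Y"
  unfolding span_mult_def by (auto intro: hecke.span_base)

lemma span_mult_subset:
  assumes "hecke.subspace M" "\<And>x y. x \<in> X \<Longrightarrow> y \<in> Y \<Longrightarrow> x * y \<in> M"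
  shows "X \<odot> Y \<subseteq> M"
  unfolding span_mult_def using assms by (intro hecke.span_minimal) (auto elim: set_times_elim)

lemma subspace_span_mult: "hecke.subspace (X \<odot> Y)"
  by (simp add: span_mult_def)

lemma t_closed_z_u2: "t_closed ({hecke_z ^ k} \<odot> hecke_u2 \<odot> Y)"
  unfolding t_closed_def
proof (intro conjI ballI)
  fix y assume "y \<in> {hecke_z ^ k} \<odot> hecke_u2 \<odot> Y"
  have sub: "hecke.subspace {y. hecke_t * y \<in> N}" if "hecke.subspace N" for N
    using that by (auto simp: hecke.subspace_def distrib_left hecke_scale_mult)
  have t_u2: "hecke_t * x \<in> {hecke_z ^ k} \<odot> hecke_u2" if "x \<in> {hecke_z ^ k} \<odot> hecke_u2" for x
  proof -
    have "{hecke_z ^ k} \<odot> hecke_u2 \<subseteq> {x. hecke_t * x \<in> {hecke_z ^ k} \<odot> hecke_u2}"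
    proof (rule span_mult_subset[OF sub[OF subspace_span_mult]], rule CollectI)
      fix a b assume a: "a \<in> {hecke_z ^ k}" and b: "b \<in> hecke_u2"
      have "hecke_t * b \<in> hecke_u2"
        using b hecke_subalgebra_u2 tp_in_u2[of 1] by (simp add: hecke_subalgebra_def)
      \<comment> \<open>Powers of \<open>z\<close> are central, so \<open>t\<close> moves past
        \<open>a\<close> and is absorbed by \<open>hecke_u2\<close>.\<close>
      moreover have "hecke_t * (a * b) = a * (hecke_t * b)"
        using a zp_central[of "int k" hecke_t] by (simp flip: mult.assoc)
      ultimately show "hecke_t * (a * b) \<in> {hecke_z ^ k} \<odot> hecke_u2"
        using a by (simp add: span_mult_base)
    qed
    with that show ?thesis
      by blast
  qed
  have "{hecke_z ^ k} \<odot> hecke_u2 \<odot> Y \<subseteq> {y. hecke_t * y \<in> {hecke_z ^ k} \<odot> hecke_u2 \<odot> Y}"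
    by (rule span_mult_subset[OF sub[OF subspace_span_mult]])
      (simp add: t_u2 span_mult_base flip: mult.assoc)
  with \<open>y \<in> _\<close> show "hecke_t * y \<in> {hecke_z ^ k} \<odot> hecke_u2 \<odot> Y"
    by blast
qed (rule subspace_span_mult)

section \<open>Elementwise sums of submodules\<close>

lemma subspace_plus:
  assumes "hecke.subspace A" "hecke.subspace B"
  shows "hecke.subspace (A + B)"
  unfolding hecke.subspace_def
proof (intro conjI ballI allI)
  show "0 \<in> A + B"
    using set_plus_intro[of 0 A 0 B] assms by (simp add: hecke.subspace_0)
next
  fix x y assume "x \<in> A + B" "y \<in> A + B"
  then obtain a b a' b' where xy: "x = a + b" "y = a' + b'" and "a \<in> A" "b \<in> B" "a' \<in> A" "b' \<in> B"
    by (elim set_plus_elim)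
  then have "(a + a') + (b + b') \<in> A + B"
    using assms by (intro set_plus_intro hecke.subspace_add)
  then show "x + y \<in> A + B"
    by (simp add: xy ac_simps)
next
  fix c x assume "x \<in> A + B"
  then obtain a b where x: "x = a + b" and "a \<in> A" "b \<in> B"
    by (rule set_plus_elim)
  then have "hecke_scale c a + hecke_scale c b \<in> A + B"
    using assms by (intro set_plus_intro hecke.subspace_scale)
  then show "hecke_scale c x \<in> A + B"
    by (simp add: x hecke.scale_right_distrib)
qed

lemma t_closed_plus:
  assumes "t_closed A" "t_closed B"
  shows "t_closed (A + B)"
  unfolding t_closed_def
proof (intro conjI ballI)
  show "hecke.subspace (A + B)"
    using assms by (simp add: t_closed_def subspace_plus)
  fix y assume "y \<in> A + B"
  then obtain a b where y: "y = a + b" and ab: "a \<in> A" "b \<in> B"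
    by (rule set_plus_elim)
  have "hecke_t * a \<in> A" "hecke_t * b \<in> B"
    using ab assms by (simp_all add: t_closed_def)
  then show "hecke_t * y \<in> A + B"
    by (simp add: y distrib_left set_plus_intro)
qed

lemma t_closed_sum:
  assumes "finite K" "\<And>k. k \<in> K \<Longrightarrow> t_closed (A k)"
  shows "t_closed (\<Sum>k\<in>K. A k)"
  using assms
proof (induction K rule: finite_induct)
  case empty
  show ?case
    by (simp add: t_closed_def hecke.subspace_def set_zero)
next
  case (insert k K)
  then show ?case
    by (simp add: t_closed_plus)
qed

lemma plus_subset:
  assumes "hecke.subspace M" "A \<subseteq> M" "B \<subseteq> M"
  shows "A + B \<subseteq> M"
proof
  fix x assume "x \<in> A + B"
  then obtain a b where "x = a + b" "a \<in> A" "b \<in> B"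
    by (rule set_plus_elim)
  with assms show "x \<in> M"
    by (simp add: hecke.subspace_add subsetD)
qed

lemma sum_subset:
  assumes "hecke.subspace M" "finite K" "\<And>k. k \<in> K \<Longrightarrow> A k \<subseteq> M"
  shows "(\<Sum>k\<in>K. A k) \<subseteq> M"
  using assms(2,3)
proof (induction K rule: finite_induct)
  case empty
  show ?case
    using hecke.subspace_0[OF assms(1)] by (simp add: set_zero)
next
  case (insert k K)
  then show ?case
    by (simp add: plus_subset[OF assms(1)])
qed

lemma subset_plus:
  assumes "hecke.subspace A" "hecke.subspace B"
  shows "A \<subseteq> A + B" "B \<subseteq> A + B"
proof -
  show "A \<subseteq> A + B"
  proof
    fix x assume "x \<in> A"
    from set_plus_intro[OF this hecke.subspace_0[OF assms(2)]] show "x \<in> A + B"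
      by simp
  qed
  show "B \<subseteq> A + B"
  proof
    fix x assume "x \<in> B"
    from set_plus_intro[OF hecke.subspace_0[OF assms(1)] this] show "x \<in> A + B"
      by simp
  qed
qed

lemma subset_sum:
  assumes "finite K" "k \<in> K" "\<And>k. k \<in> K \<Longrightarrow> t_closed (A k)"
  shows "A k \<subseteq> (\<Sum>k\<in>K. A k)"
proof -
  have "(\<Sum>k\<in>K. A k) = A k + (\<Sum>k\<in>K - {k}. A k)"
    using assms(1,2) by (rule sum.remove)
  moreover have "t_closed (\<Sum>k\<in>K - {k}. A k)"
    using assms by (intro t_closed_sum) simp_all
  then have "A k \<subseteq> A k + (\<Sum>k\<in>K - {k}. A k)"
    using assms(2,3) by (intro subset_plus) (simp_all add: t_closed_def)
  ultimately show ?thesis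
    by simp
qed

section \<open>The spanning elements of \<open>U\<close>\<close>

abbreviation hecke_U_part :: "nat \<Rightarrow> hecke set" where
  "hecke_U_part k \<equiv>
     {hecke_z ^ k} \<odot> hecke_u2 \<odot> hecke_u1
   + {hecke_z ^ k} \<odot> hecke_u2 \<odot> {hecke_s * alg_inverse hecke_t}
   + {hecke_z ^ k} \<odot> hecke_u2 \<odot> {alg_inverse hecke_s * hecke_t}
   + {hecke_z ^ k} \<odot> hecke_u2 \<odot> {alg_inverse hecke_s * hecke_t * alg_inverse hecke_s}"

lemma hecke_U_eq: "hecke_U = (\<Sum>k = 0..11. hecke_U_part k)"
  by (simp add: hecke_U_def Let_def)

lemma t_closed_U: "t_closed hecke_U"
  unfolding hecke_U_eq by (intro t_closed_sum t_closed_plus t_closed_z_u2) simp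

lemma subspace_U: "hecke.subspace hecke_U"
  using t_closed_U by (simp add: t_closed_def)

lemma base_in_U:
  assumes "0 \<le> k" "k \<le> 11"
  shows "zp k * sp j \<in> hecke_U" "zp k * (hecke_s * alg_inverse hecke_t) \<in> hecke_U"
    "zp k * (alg_inverse hecke_s * hecke_t) \<in> hecke_U"
    "zp k * (alg_inverse hecke_s * hecke_t * alg_inverse hecke_s) \<in> hecke_U"
proof -
  obtain n where n: "k = int n"
    using assms(1) nonneg_int_cases by blast
  let ?Z = "{hecke_z ^ n} \<odot> hecke_u2"
  have part: "hecke_U_part n \<subseteq> hecke_U"
    unfolding hecke_U_eq using assms(2)
    by (intro subset_sum t_closed_plus t_closed_z_u2) (simp_all add: n)
  have "hecke_z ^ n * 1 \<in> ?Z"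
    using hecke_subalgebra_u2 by (intro span_mult_base) (simp_all add: hecke_subalgebra_def)
  then have mem: "hecke_z ^ n * y \<in> ?Z \<odot> Y" if "y \<in> Y" for y Y
    using that by (simp add: span_mult_base)
  let ?A = "?Z \<odot> hecke_u1" and ?B = "?Z \<odot> {hecke_s * alg_inverse hecke_t}"
    and ?C = "?Z \<odot> {alg_inverse hecke_s * hecke_t}"
    and ?D = "?Z \<odot> {alg_inverse hecke_s * hecke_t * alg_inverse hecke_s}"
  have sub: "hecke.subspace ?A" "hecke.subspace ?B" "hecke.subspace ?C" "hecke.subspace ?D"
    by (rule subspace_span_mult)+
  note AB = subset_plus[OF sub(1,2)]
  note ABC = subset_plus[OF subspace_plus[OF sub(1,2)] sub(3)]
  note ABCD = subset_plus[OF subspace_plus[OF subspace_plus[OF sub(1,2)] sub(3)] sub(4)]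
  have incl: "?A \<subseteq> hecke_U" "?B \<subseteq> hecke_U" "?C \<subseteq> hecke_U" "?D \<subseteq> hecke_U"
    by (rule order_trans[OF _ part], rule AB ABC ABCD order_trans[OF AB(1) order_trans[OF ABC(1) ABCD(1)]]
        order_trans[OF AB(2) order_trans[OF ABC(1) ABCD(1)]] order_trans[OF ABC(2) ABCD(1)])+
  show "zp k * sp j \<in> hecke_U" "zp k * (hecke_s * alg_inverse hecke_t) \<in> hecke_U"
    "zp k * (alg_inverse hecke_s * hecke_t) \<in> hecke_U"
    "zp k * (alg_inverse hecke_s * hecke_t * alg_inverse hecke_s) \<in> hecke_U"
    using subsetD[OF incl(1) mem] subsetD[OF incl(2) mem] subsetD[OF incl(3) mem]
      subsetD[OF incl(4) mem] sp_in_u1 by (simp_all add: n)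
qed

text \<open>With \<open>base_in_U\<close>, this makes \<open>hecke_U\<close> the least
  \<open>t_closed\<close> set containing the listed elements. Centrality of \<open>z\<close> lets
  the factor from \<open>hecke_u2\<close> move to the front.\<close>

lemma U_subset:
  assumes M: "t_closed M"
    and base: "\<And>k j. 0 \<le> k \<Longrightarrow> k \<le> 11 \<Longrightarrow> zp k * sp j \<in> M"
      "\<And>k. 0 \<le> k \<Longrightarrow> k \<le> 11 \<Longrightarrow> zp k * (hecke_s * alg_inverse hecke_t) \<in> M"
      "\<And>k. 0 \<le> k \<Longrightarrow> k \<le> 11 \<Longrightarrow> zp k * (alg_inverse hecke_s * hecke_t) \<in> M"
      "\<And>k. 0 \<le> k \<Longrightarrow> k \<le> 11 \<Longrightarrow> zp k * (alg_inverse hecke_s * hecke_t * alg_inverse hecke_s) \<in> M"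
  shows "hecke_U \<subseteq> M"
proof -
  have sub: "hecke.subspace M"
    using M by (simp add: t_closed_def)
  have part: "{hecke_z ^ k} \<odot> hecke_u2 \<odot> Y \<subseteq> M" if Y: "\<And>y. y \<in> Y \<Longrightarrow> hecke_z ^ k * y \<in> M" for k Y
  proof (rule span_mult_subset[OF sub])
    fix x y assume x: "x \<in> {hecke_z ^ k} \<odot> hecke_u2" and y: "y \<in> Y"
    have "hecke.subspace {x. x * y \<in> M}"
      using sub by (auto simp: hecke.subspace_def distrib_right hecke_scale_mult)
    moreover have "hecke_z ^ k * a * y \<in> M" if "a \<in> hecke_u2" for a
    proof -
      have "hecke_z ^ k * a * y = a * (hecke_z ^ k * y)"
        using zp_central[of "int k" a] by (simp add: mult.assoc)
      with t_closed_u2[OF M that Y[OF y]] show ?thesis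
        by simp
    qed
    ultimately have "{hecke_z ^ k} \<odot> hecke_u2 \<subseteq> {x. x * y \<in> M}"
      by (intro span_mult_subset) auto
    with x show "x * y \<in> M"
      by blast
  qed
  have u1: "hecke_z ^ k * y \<in> M" if "k \<le> 11" "y \<in> hecke_u1" for k y
  proof -
    have "hecke.subspace {y. hecke_z ^ k * y \<in> M}"
      using sub by (auto simp: hecke.subspace_def distrib_left hecke_scale_mult)
    moreover have "hecke_z ^ k * sp j \<in> M" for j
      using base(1)[of "int k" j] that(1) by simp
    ultimately have "hecke_u1 \<subseteq> {y. hecke_z ^ k * y \<in> M}"
      unfolding u1_eq_span by (intro hecke.span_minimal) auto
    with that(2) show ?thesis
      by blast
  qed
  show ?thesis
    unfolding hecke_U_eq
  proof (rule sum_subset[OF sub])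
    fix k :: nat assume "k \<in> {0..11}"
    then show "hecke_U_part k \<subseteq> M"
      using u1 base(2-4)[of "int k"] by (intro plus_subset[OF sub] part) auto
  qed simp
qed

section \<open>Words modulo the centre\<close>

text \<open>
  Modulo \<open>z = x\<^sup>2\<close>, where \<open>x = st\<close>, the braid group is the free product of the cyclic groups
  generated by \<open>s\<close> and by \<open>x\<close>; the list \<open>[a\<^sub>0, \<dots>, a\<^sub>n]\<close> stands for
  \<open>s^a\<^sub>0 x s^a\<^sub>1 x \<dots> x s^a\<^sub>n\<close>.
\<close>

fun ev :: "int list \<Rightarrow> hecke" where
  "ev [] = 1"
| "ev [a] = sp a"
| "ev (a # b # w) = sp a * hx * ev (b # w)"

text \<open>Cuts a word inside a power of \<open>s\<close>, whereas \<open>ev_append\<close> cuts it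
  at an \<open>x\<close>.\<close>

lemma ev_join: "ev (u @ [a + b] @ v) = ev (u @ [a]) * ev (b # v)"
proof (induction u rule: ev.induct)
  case 1
  then show ?case
    by (cases v) (simp_all add: sp_add mult.assoc)
next
  case (2 c)
  then show ?case
    by (cases v) (simp_all add: sp_add mult.assoc)
qed (simp add: mult.assoc)

lemma ev_append: "ev (u @ [a] @ b # v) = ev (u @ [a]) * hx * ev (b # v)"
  by (induction u rule: ev.induct) (simp_all add: mult.assoc)

definition inU :: "int \<Rightarrow> int list \<Rightarrow> bool" where
  "inU k w \<longleftrightarrow> zp k * ev w \<in> hecke_U"

text \<open>A power \<open>t^i\<close> stands between two powers of \<open>s\<close>. By
  \<open>inUt_up\<close> and \<open>inUt_down\<close> each value of \<open>i\<close> gives an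
  ordinary word up to a power of \<open>z\<close>; keeping \<open>i\<close> explicit makes the
  quartic rule applicable.\<close>

definition inUt :: "int \<Rightarrow> int list \<Rightarrow> int \<Rightarrow> int \<Rightarrow> int \<Rightarrow> int list \<Rightarrow> bool" where
  "inUt k u a i b v \<longleftrightarrow> zp k * ev (u @ [a]) * tp i * ev (b # v) \<in> hecke_U"

lemma inU_s_line:
  assumes "inU k (u @ [a] @ v)" "inU k (u @ [a + 1] @ v)" "inU k (u @ [a + 2] @ v)"
  shows "inU k (u @ [b] @ v)"
proof -
  have "zp k * ev (u @ [c] @ v) = zp k * ev (u @ [0]) * sp c * ev (0 # v)" for c
    using ev_join[of u 0 c v] ev_join[of "[]" c 0 v] by (simp add: mult.assoc)
  with assms show ?thesis
    unfolding inU_def using consecutive_sp[OF subspace_U] by metis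
qed

lemma inU_t_line:
  assumes "inUt k u a i b v" "inUt k u a (i + 1) b v" "inUt k u a (i + 2) b v"
    "inUt k u a (i + 3) b v"
  shows "inUt k u a j b v"
  using assms unfolding inUt_def by (rule consecutive_tp[OF subspace_U])

text \<open>Membership in \<open>U\<close> does not see left powers of \<open>t\<close>, which
  justifies stripping words from the left.\<close>

lemma tp_mult_U: "tp i * y \<in> hecke_U \<longleftrightarrow> y \<in> hecke_U"
proof
  assume "tp i * y \<in> hecke_U"
  then have "tp (- i) * (tp i * y) \<in> hecke_U"
    by (rule t_closed_u2[OF t_closed_U tp_in_u2])
  then show "y \<in> hecke_U"
    by (simp flip: mult.assoc tp_add)
qed (rule t_closed_u2[OF t_closed_U tp_in_u2])

lemma s_inverse_hx: "sp (- 1) * hx = tp 1"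
  by (simp add: hecke_s_inverse flip: mult.assoc)

text \<open>This is \<open>x = z x^-1\<close> with \<open>x^-1 = t^-1 s^-1\<close>.\<close>

lemma hx_eq: "hx = zp 1 * tp (- 1) * sp (- 1)"
proof -
  have "zp 1 * tp (- 1) * sp (- 1) = hx * (hx * tp (- 1) * sp (- 1))"
    by (simp add: hx_hx[symmetric] mult.assoc)
  also have "hx * tp (- 1) * sp (- 1) = 1"
    by (metis hecke_s_inverse(1) hecke_t_inverse(1) ipow_simps(3) mult.assoc mult_1_right)
  finally show ?thesis
    by simp
qed

lemma hx_s: "hx * sp 1 = zp 1 * tp (- 1)"
  using hecke_s_inverse by (subst hx_eq) (simp add: mult.assoc)

lemma inU_strip_minus_1: "inU k (- 1 # b # w) \<longleftrightarrow> inU k (b # w)"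
proof -
  have "zp k * ev (- 1 # b # w) = tp 1 * (zp k * ev (b # w))"
    using s_inverse_hx zp_central[of k "tp 1"] by (simp flip: mult.assoc)
  then show ?thesis
    by (simp add: inU_def tp_mult_U del: ipow_simps)
qed

text \<open>The initial \<open>x\<close> equals \<open>z t^-1 s^-1\<close>; the \<open>t^-1\<close>
  is dropped and \<open>s^-1\<close> joins the next power of \<open>s\<close>.\<close>

lemma inU_strip_0: "inU k (0 # b # w) \<longleftrightarrow> inU (k + 1) ((b - 1) # w)"
proof -
  have "ev (0 # b # w) = zp 1 * tp (- 1) * (sp (- 1) * ev (b # w))"
    by (simp add: hx_eq[simplified] mult.assoc)
  moreover have "sp (- 1) * ev (b # w) = ev ((b - 1) # w)"
    using ev_join[of "[]" "- 1" b w] by simp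
  moreover have "zp k * (zp 1 * tp (- 1) * y) = tp (- 1) * (zp (k + 1) * y)" for y
    by (metis mult.assoc zp_add zp_central)
  ultimately show ?thesis
    by (simp add: inU_def tp_mult_U del: ipow_simps)
qed

text \<open>The trivial power of \<open>s\<close> leaves \<open>x x = z\<close>, which is
  central.\<close>

lemma inU_merge: "inU k (u @ a # 0 # b # v) \<longleftrightarrow> inU (k + 1) (u @ (a + b) # v)"
proof -
  have "ev (u @ a # 0 # b # v) = ev (u @ [a]) * (hx * hx) * ev (b # v)"
    using ev_append[of u a 0 "b # v"] by (simp add: mult.assoc)
  also have "\<dots> = hecke_z * (ev (u @ [a]) * ev (b # v))"
    by (metis hx_hx mult.assoc z_central)
  also have "ev (u @ [a]) * ev (b # v) = ev (u @ (a + b) # v)"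
    using ev_join[of u a b v] by simp
  finally show ?thesis
    by (simp add: inU_def zp_add mult.assoc)
qed

lemma inUt_0: "inUt k u a 0 b v \<longleftrightarrow> inU k (u @ (a + b) # v)"
  using ev_join[of u a b v] by (simp add: inUt_def inU_def mult.assoc)

text \<open>One factor \<open>t\<close> is rewritten as \<open>s^-1 x\<close>.\<close>

lemma inUt_up: "inUt k u a (i + 1) b v \<longleftrightarrow> inUt k (u @ [a - 1]) 0 i b v"
proof -
  have "ev ((u @ [a - 1]) @ [0]) = ev (u @ [a]) * tp 1"
    using ev_append[of u "a - 1" 0 "[]"] ev_join[of u a "- 1" "[]"] s_inverse_hx
    by (simp add: mult.assoc)
  then show ?thesis
    by (simp add: inUt_def tp_add mult.assoc add.commute[of i 1] del: append_assoc)
qed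

text \<open>One factor \<open>t^-1\<close> is rewritten as \<open>z^-1 x s\<close>, which accounts
  for the shift of \<open>k\<close>.\<close>

lemma inUt_down: "inUt k u a (i - 1) b v \<longleftrightarrow> inUt (k - 1) (u @ [a]) 1 i b v"
proof -
  have "ev ((u @ [a]) @ [1]) = zp 1 * (ev (u @ [a]) * tp (- 1))"
    using ev_append[of u a 1 "[]"] hx_s zp_central[of 1 "ev (u @ [a])"]
    by (metis append.assoc append_Cons append_Nil ev.simps(2) mult.assoc)
  moreover have "zp (k - 1) * (zp 1 * y) = zp k * y" for y
    by (simp del: ipow_simps flip: mult.assoc zp_add)
  moreover have "tp (i - 1) = tp (- 1) * tp i"
    by (simp del: ipow_simps flip: tp_add)
  ultimately show ?thesis
    by (simp add: inUt_def mult.assoc del: append_assoc ipow_simps)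
qed

lemma inUt_numeral:
  "inUt k u a 1 b v \<longleftrightarrow> inU k (u @ (a - 1) # b # v)"
  "inUt k u a 2 b v \<longleftrightarrow> inU k (u @ (a - 1) # - 1 # b # v)"
  "inUt k u a 3 b v \<longleftrightarrow> inU k (u @ (a - 1) # - 1 # - 1 # b # v)"
  "inUt k u a 4 b v \<longleftrightarrow> inU k (u @ (a - 1) # - 1 # - 1 # - 1 # b # v)"
  "inUt k u a (- 1) b v \<longleftrightarrow> inU (k - 1) (u @ a # (b + 1) # v)"
  "inUt k u a (- 2) b v \<longleftrightarrow> inU (k - 2) (u @ a # 1 # (b + 1) # v)"
  "inUt k u a (- 3) b v \<longleftrightarrow> inU (k - 3) (u @ a # 1 # 1 # (b + 1) # v)"
  "inUt k u a (- 4) b v \<longleftrightarrow> inU (k - 4) (u @ a # 1 # 1 # 1 # (b + 1) # v)"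
  using inUt_up[where i = 0] inUt_up[where i = 1] inUt_up[where i = 2] inUt_up[where i = 3]
    inUt_down[where i = 0] inUt_down[where i = "- 1"] inUt_down[where i = "- 2"]
    inUt_down[where i = "- 3"]
  by (simp_all add: inUt_0 add.commute)

text \<open>Each rule shortens a word or turns \<open>inUt\<close> into \<open>inU\<close>. The
  prefixes in \<open>inU_merge\<close> are instantiated because the pattern \<open>u @ _\<close>
  does not match an explicit list.\<close>

lemmas inU_normalize = inU_strip_minus_1 inU_strip_0 inUt_0 inUt_numeral
  inU_merge[of _ "[]", simplified]
  inU_merge[of _ "[c\<^sub>1]" for c\<^sub>1, simplified]
  inU_merge[of _ "[c\<^sub>1, c\<^sub>2]" for c\<^sub>1 c\<^sub>2, simplified]
  inU_merge[of _ "[c\<^sub>1, c\<^sub>2, c\<^sub>3]" for c\<^sub>1 c\<^sub>2 c\<^sub>3, simplified]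
  inU_merge[of _ "[c\<^sub>1, c\<^sub>2, c\<^sub>3, c\<^sub>4]" for c\<^sub>1 c\<^sub>2 c\<^sub>3 c\<^sub>4, simplified]

text \<open>Uses \<open>t^-1 = z^-1 x s\<close> and \<open>t = s^-1 x\<close>. The last power of
  \<open>s\<close> is split off to fit \<open>inU_mult_s\<close> and
  \<open>inU_mult_t\<close>.\<close>

lemma basis_words:
  "hecke_s * alg_inverse hecke_t = zp (- 1) * ev ([1] @ [1])"
  "alg_inverse hecke_s * hecke_t = ev ([- 2] @ [0])"
  "alg_inverse hecke_s * hecke_t * alg_inverse hecke_s = ev ([- 2] @ [- 1])"
proof -
  have "zp (- 1) * ev ([1] @ [1]) = zp (- 1) * sp 1 * (hx * sp 1)"
    by (simp add: mult.assoc)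
  also have "\<dots> = zp (- 1) * zp 1 * sp 1 * tp (- 1)"
    unfolding hx_s by (metis mult.assoc zp_central)
  also have "\<dots> = hecke_s * alg_inverse hecke_t"
    by (simp del: ipow_simps(2,3) flip: zp_add) simp
  finally show "hecke_s * alg_inverse hecke_t = zp (- 1) * ev ([1] @ [1])"
    by simp
  have "sp (- 2) * hx = sp (- 1) * (sp (- 1) * hx)"
    by (simp del: ipow_simps flip: mult.assoc sp_add)
  also have "\<dots> = alg_inverse hecke_s * hecke_t"
    by (subst s_inverse_hx) simp
  finally show "alg_inverse hecke_s * hecke_t = ev ([- 2] @ [0])"
    "alg_inverse hecke_s * hecke_t * alg_inverse hecke_s = ev ([- 2] @ [- 1])"
    by (simp_all flip: mult.assoc)
qed

lemma base_s: "0 \<le> k \<Longrightarrow> k \<le> 11 \<Longrightarrow> inU k [b]"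
  by (simp add: inU_def base_in_U)

text \<open>The factor \<open>z^-1\<close> in the word for \<open>s t^-1\<close> moves the range of
  exponents down by one.\<close>

lemma base_1_1: "- 1 \<le> k \<Longrightarrow> k \<le> 10 \<Longrightarrow> inU k [1, 1]"
  using base_in_U(2)[of "k + 1"] unfolding basis_words mult.assoc[symmetric] zp_add[symmetric]
  by (simp add: inU_def)

lemma base_2_0: "0 \<le> k \<Longrightarrow> k \<le> 11 \<Longrightarrow> inU k [- 2, 0]"
  using base_in_U(3) by (simp add: inU_def basis_words)

lemma base_2_1: "0 \<le> k \<Longrightarrow> k \<le> 11 \<Longrightarrow> inU k [- 2, - 1]"
  using base_in_U(4) unfolding basis_words by (simp add: inU_def)

section \<open>Filling lines\<close>

text \<open>
  The words and the order of the steps were found by a computer search; \<open>inU_normalize\<close> computes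
  the normal form of a word modulo left multiplication by powers of \<open>t\<close>.
\<close>

lemma line_1: "1 \<le> k \<Longrightarrow> k \<le> 11 \<Longrightarrow> inUt k [] (- 1) j 0 []"
  using base_1_1[of "k - 2"] base_s[of "k - 1" 1] base_s[of k "- 1"] base_2_0[of k]
    inU_t_line[of k "[]" "- 1" "- 2" 0 "[]" j]
  by (simp add: inU_normalize)

text \<open>The members \<open>b = -2, -1, 0\<close> normalize to \<open>[-2, 0]\<close>,
  \<open>[0]\<close> and, one exponent higher, \<open>[-1]\<close>; the last one is the reason for
  the bound 10. The other lines are read in the same way.\<close>

lemma line_2: "0 \<le> k \<Longrightarrow> k \<le> 10 \<Longrightarrow> inU k [b, 0]"
  using base_2_0[of k] base_s[of k 0] base_s[of "k + 1" "- 1"] inU_s_line[of k "[]" "- 2" "[0]" b]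
  by (simp add: inU_normalize)

lemma line_3: "0 \<le> k \<Longrightarrow> k \<le> 10 \<Longrightarrow> inU k [b, 1]"
  using base_s[of k 1] base_s[of "k + 1" 0] base_1_1[of k] inU_s_line[of k "[]" "- 1" "[1]" b]
  by (simp add: inU_normalize)

lemma line_4: "1 \<le> k \<Longrightarrow> k \<le> 10 \<Longrightarrow> inU k [b, - 1, 0]"
  using line_1[of k 2] base_s[of k 0] base_2_0[of "k + 1"]
    inU_s_line[of k "[]" "- 2" "[- 1, 0]" b]
  by (simp add: inU_normalize)

lemma line_5: "inUt 5 [] 2 j 0 []"
  using line_3[of 4 2] base_s[of 5 2] line_2[of 5 1] line_4[of 5 1]
    inU_t_line[of 5 "[]" 2 "- 1" 0 "[]" j]
  by (simp add: inU_normalize)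

lemma line_6: "1 \<le> k \<Longrightarrow> k \<le> 10 \<Longrightarrow> inUt k [] 1 j (- 1) []"
  using line_2[of "k - 1" 1] base_s[of k 0] base_s[of "k + 1" "- 2"] base_2_1[of "k + 1"]
    inU_t_line[of k "[]" 1 "- 1" "- 1" "[]" j]
  by (simp add: inU_normalize)

lemma line_7: "5 \<le> k \<Longrightarrow> k \<le> 10 \<Longrightarrow> inUt k [] (- 2) j 0 []"
  using line_3[of "k - 1" "- 2"] base_s[of k "- 2"] line_2[of k "- 3"] line_4[of k "- 3"]
    inU_t_line[of k "[]" "- 2" "- 1" 0 "[]" j]
  by (simp add: inU_normalize)

lemma line_8: "0 \<le> k \<Longrightarrow> k \<le> 10 \<Longrightarrow> inU k [- 2, b]"
  using base_2_1[of k] base_2_0[of k] line_3[of k "- 2"] inU_s_line[of k "[- 2]" "- 1" "[]" b]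
  by (simp add: inU_normalize)

lemma line_9: "0 \<le> k \<Longrightarrow> k \<le> 10 \<Longrightarrow> inU k [b, 2]"
  using line_8[of k 2] base_s[of k 2] base_s[of "k + 1" 1] inU_s_line[of k "[]" "- 2" "[2]" b]
  by (simp add: inU_normalize)

section \<open>Lines at exponents 1 to 9\<close>

lemma line_10: "2 \<le> k \<Longrightarrow> k \<le> 5 \<Longrightarrow> inU k [b, 1, 1, 0]"
  using line_6[of "2 + k" "- 2"] base_s[of "3 + k" "- 1"] line_6[of "3 + k" "- 3"]
    inU_s_line[of k "[]" "- 1" "[1, 1, 0]" b]
  by (simp add: inU_normalize)

lemma line_11: "inU 7 [b, 1, 1, 0]"
  using line_6[of 9 "- 2"] base_s[of 10 "- 1"] line_6[of 10 "- 3"]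
    inU_s_line[of 7 "[]" "- 1" "[1, 1, 0]" b]
  by (simp add: inU_normalize)

lemma line_12: "1 \<le> k \<Longrightarrow> k \<le> 9 \<Longrightarrow> inUt k [] 1 j 1 []"
  using line_9[of "k - 1" 1] base_s[of k 2] base_s[of "k + 1" 0] line_3[of "k + 1" "- 2"]
    inU_t_line[of k "[]" 1 "- 1" 1 "[]" j]
  by (simp add: inU_normalize)

text \<open>With \<open>line_14\<close> and \<open>line_15\<close> this is one family, taken at the
  exponents 2, 4, 5, 7, 8 at which later lines quote it.\<close>

lemma line_13: "inU 2 [- 2, - 1, b]"
  using line_6[of 1 3] line_1[of 2 2] line_12[of 1 3] inU_s_line[of 2 "[- 2, - 1]" "- 1" "[]" b]
  by (simp add: inU_normalize)

lemma line_14: "4 \<le> k \<Longrightarrow> k \<le> 5 \<Longrightarrow> inU k [- 2, - 1, b]"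
  using line_6[of "k - 1" 3] line_1[of k 2] line_12[of "k - 1" 3]
    inU_s_line[of k "[- 2, - 1]" "- 1" "[]" b]
  by (simp add: inU_normalize)

lemma line_15: "7 \<le> k \<Longrightarrow> k \<le> 8 \<Longrightarrow> inU k [- 2, - 1, b]"
  using line_6[of "k - 1" 3] line_1[of k 2] line_12[of "k - 1" 3]
    inU_s_line[of k "[- 2, - 1]" "- 1" "[]" b]
  by (simp add: inU_normalize)

lemma line_16: "2 \<le> k \<Longrightarrow> k \<le> 8 \<Longrightarrow> inU k [b, 1, 0]"
  using line_2[of k 1] base_s[of "2 + k" "- 1"] line_6[of "2 + k" "- 2"]
    inU_s_line[of k "[]" "- 1" "[1, 0]" b]
  by (simp add: inU_normalize)

lemma line_17: "1 \<le> k \<Longrightarrow> k \<le> 8 \<Longrightarrow> inU k [1, b, 0]"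
  using line_4[of k 1] base_s[of "k + 1" 1] line_6[of "2 + k" "- 2"]
    inU_s_line[of k "[1]" "- 1" "[0]" b]
  by (simp add: inU_normalize)

lemma line_18: "2 \<le> k \<Longrightarrow> k \<le> 4 \<Longrightarrow> inU k [b, - 1, 1]"
  using line_12[of "k - 1" 3] base_s[of k 1] line_3[of "k + 1" "- 2"]
    inU_s_line[of k "[]" "- 2" "[- 1, 1]" b]
  by (simp add: inU_normalize)

lemma line_19: "inU 6 [b, - 1, 1]"
  using line_12[of 5 3] base_s[of 6 1] line_3[of 7 "- 2"] inU_s_line[of 6 "[]" "- 2" "[- 1, 1]" b]
  by (simp add: inU_normalize)

lemma line_20: "inU 9 [b, - 1, 1]"
  using line_12[of 8 3] base_s[of 9 1] line_3[of 10 "- 2"]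
    inU_s_line[of 9 "[]" "- 2" "[- 1, 1]" b]
  by (simp add: inU_normalize)

text \<open>The value \<open>b = -2\<close> is needed for \<open>s^-1 t s^-1 t\<close>; this covers
  the exponents 1 to 8 of that product.\<close>

lemma line_21: "1 \<le> k \<Longrightarrow> k \<le> 8 \<Longrightarrow> inU k [b, - 2, 0]"
  using base_2_0[of k] line_2[of "k + 1" "- 3"] line_17[of k "- 2"]
    inU_s_line[of k "[]" "- 1" "[- 2, 0]" b]
  by (simp add: inU_normalize)

lemma line_22: "inUt 4 [] (- 2) j 1 []"
  using line_8[of 3 2] base_s[of 4 "- 1"] line_3[of 4 "- 3"] line_18[of 4 "- 3"]
    inU_t_line[of 4 "[]" "- 2" "- 1" 1 "[]" j]
  by (simp add: inU_normalize)

lemma line_23: "inUt 6 [] (- 2) j 1 []"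
  using line_8[of 5 2] base_s[of 6 "- 1"] line_3[of 6 "- 3"] line_19[of "- 3"]
    inU_t_line[of 6 "[]" "- 2" "- 1" 1 "[]" j]
  by (simp add: inU_normalize)

lemma line_24: "inUt 9 [] (- 2) j 1 []"
  using line_8[of 8 2] base_s[of 9 "- 1"] line_3[of 9 "- 3"] line_20[of "- 3"]
    inU_t_line[of 9 "[]" "- 2" "- 1" 1 "[]" j]
  by (simp add: inU_normalize)

lemma line_25: "3 \<le> k \<Longrightarrow> k \<le> 8 \<Longrightarrow> inU k [- 2, b, 1]"
  using line_12[of "k - 1" 3] base_s[of "k + 1" "- 1"] line_7[of "2 + k" "- 2"]
    inU_s_line[of k "[- 2]" "- 1" "[1]" b]
  by (simp add: inU_normalize)

lemma line_26: "inU 2 [- 2, b, 2]"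
  using line_13[of 2] base_s[of 3 0] line_22[of "- 2"] inU_s_line[of 2 "[- 2]" "- 1" "[2]" b]
  by (simp add: inU_normalize)

lemma line_27: "inU 7 [- 2, b, 2]"
  using line_15[of 7 2] base_s[of 8 0] line_24[of "- 2"] inU_s_line[of 7 "[- 2]" "- 1" "[2]" b]
  by (simp add: inU_normalize)

lemma line_28: "inUt 8 [- 2] 0 j (- 2) [0]"
  using line_4[of 6 1] base_s[of 7 0] line_2[of 8 "- 3"] line_21[of 8 "- 2"]
    inU_t_line[of 8 "[- 2]" 0 "- 3" "- 2" "[0]" j]
  by (simp add: inU_normalize)

lemma line_29: "inUt 2 [] 1 j 1 [0]"
  using line_17[of 1 2] line_2[of 2 2] base_s[of 4 "- 1"] line_16[of 3 "- 2"]
    inU_t_line[of 2 "[]" 1 "- 1" 1 "[0]" j]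
  by (simp add: inU_normalize)

lemma line_30: "4 \<le> k \<Longrightarrow> k \<le> 6 \<Longrightarrow> inUt k [] 1 j 1 [0]"
  using line_17[of "k - 1" 2] line_2[of k 2] base_s[of "2 + k" "- 1"] line_16[of "k + 1" "- 2"]
    inU_t_line[of k "[]" 1 "- 1" 1 "[0]" j]
  by (simp add: inU_normalize)

lemma line_31: "inU 5 [b, 1, - 1, 0]"
  using line_4[of 5 1] base_2_0[of 7] line_28[of "- 4"]
    inU_s_line[of 5 "[]" "- 1" "[1, - 1, 0]" b]
  by (simp add: inU_normalize)

lemma line_32: "inU 2 [b, 2, 2]"
  using line_26[of 2] line_9[of 2 2] line_9[of 3 1] inU_s_line[of 2 "[]" "- 2" "[2, 2]" b]
  by (simp add: inU_normalize)

lemma line_33: "inU 7 [- 2, - 2, b]"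
  using line_21[of 7 "- 2"] line_25[of 7 "- 2"] line_27[of "- 2"]
    inU_s_line[of 7 "[- 2, - 2]" 0 "[]" b]
  by (simp add: inU_normalize)

lemma line_34: "3 \<le> k \<Longrightarrow> k \<le> 5 \<Longrightarrow> inUt k [] 1 j (- 2) [1]"
  using line_18[of "k - 1" 1] base_s[of k 1] line_3[of "k + 1" "- 3"] line_25[of "k + 1" "- 2"]
    inU_t_line[of k "[]" 1 "- 1" "- 2" "[1]" j]
  by (simp add: inU_normalize)

lemma line_35: "4 \<le> k \<Longrightarrow> k \<le> 6 \<Longrightarrow> inU k [- 2, - 1, b, 1]"
  using line_34[of "k - 1" 3] line_12[of "k - 1" 4] base_2_0[of "k + 1"]
    inU_s_line[of k "[- 2, - 1]" "- 2" "[1]" b]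
  by (simp add: inU_normalize)

lemma line_36: "inU 3 [- 2, b, 1, 0]"
  using line_29[of 3] base_s[of 4 0] line_10[of 3 "- 2"] inU_s_line[of 3 "[- 2]" "- 1" "[1, 0]" b]
  by (simp add: inU_normalize)

lemma line_37: "inU 7 [- 2, b, 1, 0]"
  using line_30[of 6 3] base_s[of 8 0] line_11[of "- 2"] inU_s_line[of 7 "[- 2]" "- 1" "[1, 0]" b]
  by (simp add: inU_normalize)

text \<open>The member \<open>t^-2\<close> of a line at exponent \<open>k\<close> is a word at
  exponent \<open>k - 2\<close>. In this way \<open>line_32\<close> at exponent 2 contributes to a
  line at exponent 4, and memberships climb.\<close>

lemma line_38: "inUt 4 [] (- 1) j 1 [2]"
  using line_32[of 1] line_9[of 3 2] base_s[of 5 1] line_23[of "- 2"]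
    inU_t_line[of 4 "[]" "- 1" "- 2" 1 "[2]" j]
  by (simp add: inU_normalize)

lemma line_39: "4 \<le> k \<Longrightarrow> k \<le> 6 \<Longrightarrow> inU k [- 2, b, 1, 1]"
  using line_35[of k 1] base_s[of "k + 1" 1] line_7[of "3 + k" "- 3"]
    inU_s_line[of k "[- 2]" "- 1" "[1, 1]" b]
  by (simp add: inU_normalize)

lemma line_40: "inU 3 [b, 2, 1, 0]"
  using line_36[of 2] line_16[of 3 2] line_6[of 6 "- 2"] inU_s_line[of 3 "[]" "- 2" "[2, 1, 0]" b]
  by (simp add: inU_normalize)

lemma line_41: "inU 3 [b, 1, - 1, 1]"
  using line_18[of 3 1] line_3[of 5 "- 2"] line_34[of 5 "- 2"]
    inU_s_line[of 3 "[]" "- 1" "[1, - 1, 1]" b]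
  by (simp add: inU_normalize)

lemma line_42: "inUt 5 [- 2] 2 j 0 []"
  using line_25[of 4 2] line_8[of 5 2] line_16[of 5 "- 2"] line_31[of "- 2"]
    inU_t_line[of 5 "[- 2]" 2 "- 1" 0 "[]" j]
  by (simp add: inU_normalize)

lemma line_43: "6 \<le> k \<Longrightarrow> k \<le> 8 \<Longrightarrow> inUt k [- 2] 2 j 0 []"
  using line_39[of "k - 2" 2] line_25[of "k - 1" 2] line_8[of k 2] line_16[of k "- 2"]
    inU_t_line[of k "[- 2]" 2 "- 2" 0 "[]" j]
  by (simp add: inU_normalize)

lemma line_44: "inUt 7 [- 2] (- 1) j (- 1) []"
  using line_30[of 4 3] line_1[of 6 2] line_8[of 7 "- 2"] line_33[of "- 1"]
    inU_t_line[of 7 "[- 2]" "- 1" "- 2" "- 1" "[]" j]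
  by (simp add: inU_normalize)

lemma line_45: "inUt 3 [] 1 j 1 [1, 0]"
  using line_16[of 3 2] base_s[of 6 "- 1"] line_10[of 4 "- 2"] line_44[of "- 3"]
    inU_t_line[of 3 "[]" 1 0 1 "[1, 0]" j]
  by (simp add: inU_normalize)

lemma line_46: "inUt 4 [] 1 j 1 [1, 0]"
  using line_40[of 1] line_16[of 4 2] base_s[of 7 "- 1"] line_10[of 5 "- 2"]
    inU_t_line[of 4 "[]" 1 "- 1" 1 "[1, 0]" j]
  by (simp add: inU_normalize)

lemma line_47: "6 \<le> k \<Longrightarrow> k \<le> 7 \<Longrightarrow> inUt k [- 2, - 2] 0 j 0 []"
  using line_35[of "k - 2" 1] line_12[of "k - 2" 3] base_2_1[of k] line_21[of k "- 2"]
    inU_t_line[of k "[- 2, - 2]" 0 "- 3" 0 "[]" j]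
  by (simp add: inU_normalize)

lemma line_48: "inUt 6 [- 2, - 2] 0 j 1 []"
  using line_38[of 2] line_14[of 5 2] base_2_0[of 6] line_25[of 6 "- 2"]
    inU_t_line[of 6 "[- 2, - 2]" 0 "- 3" 1 "[]" j]
  by (simp add: inU_normalize)

lemma line_49: "inUt 7 [] (- 1) j (- 2) [- 1, 0]"
  using line_5[of 3] base_s[of 6 0] line_4[of 7 "- 3"] line_47[of 7 1]
    inU_t_line[of 7 "[]" "- 1" "- 2" "- 2" "[- 1, 0]" j]
  by (simp add: inU_normalize)

lemma line_50: "inU 7 [- 2, - 2, b, 0]"
  using line_47[of 7 1] line_8[of 8 "- 2"] line_37[of "- 2"]
    inU_s_line[of 7 "[- 2, - 2]" "- 1" "[0]" b]
  by (simp add: inU_normalize)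

lemma line_51: "inUt 8 [- 2] (- 1) j (- 1) []"
  using line_46[of 3] line_30[of 5 3] line_1[of 7 2] line_8[of 8 "- 2"]
    inU_t_line[of 8 "[- 2]" "- 1" "- 3" "- 1" "[]" j]
  by (simp add: inU_normalize)

text \<open>In \<open>line_39\<close> the member \<open>b = -1\<close> is an input. Here the window
  is moved to 0, 1, 2, so that \<open>b = -1\<close> is new; through \<open>line_55\<close> and
  \<open>line_57\<close> it leads to \<open>line_63\<close>.\<close>

lemma line_52: "inU 3 [- 2, b, 1, 1]"
  using base_s[of 4 1] line_7[of 6 "- 3"] line_42[of "- 2"] inU_s_line[of 3 "[- 2]" 0 "[1, 1]" b]
  by (simp add: inU_normalize)

lemma line_53: "6 \<le> k \<Longrightarrow> k \<le> 8 \<Longrightarrow> inU k [b, 1, - 1, 0]"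
  using line_43[of k 2] line_4[of k 1] base_2_0[of "2 + k"]
    inU_s_line[of k "[]" "- 2" "[1, - 1, 0]" b]
  by (simp add: inU_normalize)

lemma line_54: "inU 2 [b, 2, 1, 0]"
  using line_16[of 2 2] line_6[of 5 "- 2"] line_45[of "- 1"]
    inU_s_line[of 2 "[]" "- 1" "[2, 1, 0]" b]
  by (simp add: inU_normalize)

lemma line_55: "inU 3 [- 2, - 1, b, 1]"
  using line_12[of 2 4] base_2_0[of 4] line_52[of "- 1"]
    inU_s_line[of 3 "[- 2, - 1]" "- 1" "[1]" b]
  by (simp add: inU_normalize)

lemma line_56: "inU 2 [- 2, b, 1, 0]"
  using base_s[of 3 0] line_10[of 2 "- 2"] line_54[of "- 2"] inU_s_line[of 2 "[- 2]" 0 "[1, 0]" b]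
  by (simp add: inU_normalize)

lemma line_57: "inUt 2 [] 1 j (- 2) [1]"
  using base_s[of 2 1] line_3[of 3 "- 3"] line_25[of 3 "- 2"] line_55[of "- 2"]
    inU_t_line[of 2 "[]" 1 0 "- 2" "[1]" j]
  by (simp add: inU_normalize)

lemma line_58: "inUt 1 [] 1 j 1 [0]"
  using line_2[of 1 2] base_s[of 3 "- 1"] line_16[of 2 "- 2"] line_56[of "- 1"]
    inU_t_line[of 1 "[]" 1 0 1 "[0]" j]
  by (simp add: inU_normalize)

section \<open>The ends of the exponent range and the chains leading there\<close>

lemma line_59: "9 \<le> k \<Longrightarrow> k \<le> 10 \<Longrightarrow> inUt k [- 2] 0 j (- 2) [0]"
  \<comment> \<open>Compared with \<open>line_28\<close> the window is moved to
    \<open>t^-4, ..., t^-1\<close>, so that \<open>j = 0\<close>, the word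
    \<open>[-2, -2, 0]\<close>, becomes a conclusion.\<close>
  using line_53[of "k - 3" 1] line_4[of "k - 2" 1] base_s[of "k - 1" 0] line_2[of k "- 3"]
    inU_t_line[of k "[- 2]" 0 "- 4" "- 2" "[0]" j]
  by (simp add: inU_normalize)

text \<open>At exponent 7, \<open>line_27\<close> came first and gave \<open>line_33\<close>. At
  exponent 8 the order is reversed: the word \<open>[-2, 1, 2]\<close> that would start the analogue
  of \<open>line_27\<close> is itself needed for \<open>line_62\<close>.\<close>

lemma line_60: "inU 8 [- 2, - 2, b]"
  using line_51[of 1] line_21[of 8 "- 2"] line_25[of 8 "- 2"]
    inU_s_line[of 8 "[- 2, - 2]" "- 1" "[]" b]
  by (simp add: inU_normalize)

lemma line_61: "inU 8 [- 2, b, 2]"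
  using line_60[of 2] line_15[of 8 2] base_s[of 9 0] inU_s_line[of 8 "[- 2]" "- 2" "[2]" b]
  by (simp add: inU_normalize)

lemma line_62: "inUt 10 [] (- 2) j 1 []"
  using line_61[of 1] line_8[of 9 2] base_s[of 10 "- 1"] line_3[of 10 "- 3"]
    inU_t_line[of 10 "[]" "- 2" "- 2" 1 "[]" j]
  by (simp add: inU_normalize)

lemma line_63: "inU 1 [b, - 1, 1]"
  using base_s[of 1 1] line_3[of 2 "- 2"] line_57[of "- 1"]
    inU_s_line[of 1 "[]" "- 1" "[- 1, 1]" b]
  by (simp add: inU_normalize)

text \<open>The window of \<open>line_18\<close> to \<open>line_20\<close> ends at
  \<open>b = 0\<close>, which here is \<open>[-2, 1]\<close> at exponent 11 and beyond
  \<open>line_3\<close>. Starting at \<open>b = -3\<close> instead makes that word a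
  conclusion.\<close>

lemma line_64: "inU 10 [b, - 1, 1]"
  using line_62[of 2] line_12[of 9 3] base_s[of 10 1] inU_s_line[of 10 "[]" "- 3" "[- 1, 1]" b]
  by (simp add: inU_normalize)

lemma line_65: "inU 0 [1, b, 0]"
  using base_s[of 1 1] line_6[of 2 "- 2"] line_58[of "- 1"] inU_s_line[of 0 "[1]" 0 "[0]" b]
  by (simp add: inU_normalize)

text \<open>Begins the chain up to \<open>line_74\<close>, which climbs from exponent 1 to exponent
  10, each line using the one before it.\<close>

lemma line_66: "inUt 1 [] 2 j 1 []"
  using line_9[of 0 2] base_s[of 1 3] base_1_1[of 1] line_57[of "- 1"]
    inU_t_line[of 1 "[]" 2 "- 1" 1 "[]" j]
  by (simp add: inU_normalize)

lemma line_67: "inU 1 [1, b, - 1, 1]"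
  using line_66[of 3] base_s[of 3 0] line_34[of 3 "- 2"] inU_s_line[of 1 "[1]" "- 1" "[- 1, 1]" b]
  by (simp add: inU_normalize)

lemma line_68: "inUt 3 [] (- 1) j 1 [- 1, 1]"
  using line_67[of 2] line_18[of 2 2] line_3[of 4 "- 2"] line_41[of "- 2"]
    inU_t_line[of 3 "[]" "- 1" "- 2" 1 "[- 1, 1]" j]
  by (simp add: inU_normalize)

lemma line_69: "inU 3 [- 2, - 1, 1, b, 1]"
  using line_68[of 2] line_14[of 4 2] line_47[of 6 "- 4"]
    inU_s_line[of 3 "[- 2, - 1, 1]" "- 1" "[1]" b]
  by (simp add: inU_normalize)

lemma line_70: "inUt 5 [- 2] (- 1) j 1 [1]"
  using line_69[of 2] line_35[of 4 2] base_s[of 6 "- 1"] line_39[of 5 "- 2"]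
    inU_t_line[of 5 "[- 2]" "- 1" "- 2" 1 "[1]" j]
  by (simp add: inU_normalize)

lemma line_71: "inUt 7 [- 2, - 2, - 2] 0 j 0 []"
  using line_70[of 2] line_48[of 1] line_33[of "- 1"] line_50[of "- 2"]
    inU_t_line[of 7 "[- 2, - 2, - 2]" 0 "- 3" 0 "[]" j]
  by (simp add: inU_normalize)

lemma line_72: "inU 7 [- 2, b, - 2, - 1, 0]"
  using line_71[of 1] line_49[of 2] line_4[of 8 "- 4"]
    inU_s_line[of 7 "[- 2]" "- 2" "[- 2, - 1, 0]" b]
  by (simp add: inU_normalize)

lemma line_73: "inU 7 [- 2, 1, b, - 1, 0]"
  using line_72[of 1] line_43[of 7 3] base_s[of 9 "- 2"]
    inU_s_line[of 7 "[- 2, 1]" "- 2" "[- 1, 0]" b]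
  by (simp add: inU_normalize)

lemma line_74: "inUt 10 [] (- 2) j (- 2) [0]"
  using line_73[of 1] line_43[of 8 2] line_1[of 9 2] line_2[of 10 "- 4"]
    inU_t_line[of 10 "[]" "- 2" "- 3" "- 2" "[0]" j]
  by (simp add: inU_normalize)

lemma line_75: "inU 0 [b, - 2, 0]"
  using base_2_0[of 0] line_2[of 1 "- 3"] line_65[of "- 2"]
    inU_s_line[of 0 "[]" "- 1" "[- 2, 0]" b]
  by (simp add: inU_normalize)

text \<open>At \<open>b = 0\<close> the word normalizes to \<open>[-3, 0]\<close> at exponent 11,
  which is beyond \<open>line_2\<close>; \<open>line_77\<close> and \<open>line_80\<close> depend on
  it.\<close>

lemma line_76: "inU 10 [b, - 2, 0]"
  using line_74[of 1] line_59[of 10 0] base_2_0[of 10] inU_s_line[of 10 "[]" "- 3" "[- 2, 0]" b]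
  by (simp add: inU_normalize)

lemma line_77: "inUt 11 [- 2] 0 j (- 2) [0]"
  using line_53[of 8 1] line_4[of 9 1] base_s[of 10 0] line_76[of 0]
    inU_t_line[of 11 "[- 2]" 0 "- 4" "- 2" "[0]" j]
  by (simp add: inU_normalize)

text \<open>At \<open>j = -1\<close> this is \<open>[1, 2]\<close> at exponent -1, that is,
  \<open>s t^-1 s\<close> without a power of \<open>z\<close>.\<close>

lemma line_78: "inUt 0 [] 1 j 1 []"
  using base_s[of 0 2] base_s[of 1 0] line_3[of 1 "- 2"] line_63[of "- 2"]
    inU_t_line[of 0 "[]" 1 0 1 "[]" j]
  by (simp add: inU_normalize)

lemma line_79: "inU 0 [b, - 1, 0]"
  using base_s[of 0 0] base_2_0[of 1] line_65[of "- 1"] inU_s_line[of 0 "[]" "- 1" "[- 1, 0]" b]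
  by (simp add: inU_normalize)

text \<open>The member \<open>b = 0\<close> used in \<open>line_2\<close> would be
  \<open>[-1]\<close> at exponent 12; \<open>b = -3\<close> takes its place.\<close>

lemma line_80: "inU 11 [b, 0]"
  using line_76[of 0] base_2_0[of 11] base_s[of 11 0] inU_s_line[of 11 "[]" "- 3" "[0]" b]
  by (simp add: inU_normalize)

section \<open>\<open>U\<close> is a right ideal\<close>

lemma inU_mult_s: "zp k * ev (u @ [a]) * hecke_s \<in> hecke_U \<longleftrightarrow> inU k (u @ [a + 1])"
  using ev_join[of u a 1 "[]"] by (simp add: inU_def mult.assoc)

lemma inU_mult_t: "zp k * ev (u @ [a]) * hecke_t \<in> hecke_U \<longleftrightarrow> inU k (u @ [a - 1, 0])"
  using inUt_numeral(1)[of k u a 0 "[]"] by (simp add: inUt_def)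

text \<open>Right multiplication commutes with left multiplication by \<open>t\<close>. By
  \<open>U_subset\<close> it then suffices to multiply the spanning elements on the right.\<close>

lemma t_closed_vimage: "t_closed {y. y * a \<in> hecke_U}"
  using t_closed_U unfolding t_closed_def hecke.subspace_def
  by (simp add: distrib_right hecke_scale_mult mult.assoc)

lemma U_mult_s: "y \<in> hecke_U \<Longrightarrow> y * hecke_s \<in> hecke_U"
proof -
  have "hecke_U \<subseteq> {y. y * hecke_s \<in> hecke_U}"
  proof (rule U_subset[OF t_closed_vimage])
    fix k j :: int
    assume k: "0 \<le> k" "k \<le> 11"
    show "zp k * sp j \<in> {y. y * hecke_s \<in> hecke_U}"
      using base_s[OF k, of "j + 1"] inU_mult_s[of k "[]" j] by simp
    \<comment> \<open>This is \<open>s t^-1 s\<close>, whose word carries \<open>z^-1\<close>; hence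
      exponent -1 occurs at \<open>k = 0\<close>.\<close>
    have "inU (k - 1) [1, 2]"
      using line_9[of "k - 1" 1] line_78[of "- 1"] k
      by (cases "k = 0") (simp_all add: inU_normalize)
    then show "zp k * (hecke_s * alg_inverse hecke_t) \<in> {y. y * hecke_s \<in> hecke_U}"
      using inU_mult_s[of "k - 1" "[1]" 1] zp_add[of k "- 1"]
      unfolding basis_words by (simp del: ipow_simps flip: mult.assoc)
    \<comment> \<open>At \<open>k = 11\<close> the word is the normal form of
      \<open>[0, -1, 1]\<close> at exponent 10.\<close>
    have "inU k [- 2, 1]"
      using line_3[of k "- 2"] line_64[of 0] k by (cases "k = 11") (simp_all add: inU_normalize)
    then show "zp k * (alg_inverse hecke_s * hecke_t) \<in> {y. y * hecke_s \<in> hecke_U}"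
      using inU_mult_s[of k "[- 2]" 0] unfolding basis_words by simp
    show "zp k * (alg_inverse hecke_s * hecke_t * alg_inverse hecke_s) \<in>
        {y. y * hecke_s \<in> hecke_U}"
      using inU_mult_s[of k "[- 2]" "- 1"] base_2_0[OF k] unfolding basis_words by simp
  qed
  then show "y \<in> hecke_U \<Longrightarrow> y * hecke_s \<in> hecke_U"
    by blast
qed

lemma U_mult_t: "y \<in> hecke_U \<Longrightarrow> y * hecke_t \<in> hecke_U"
proof -
  have "hecke_U \<subseteq> {y. y * hecke_t \<in> hecke_U}"
  proof (rule U_subset[OF t_closed_vimage])
    fix k j :: int
    assume k: "0 \<le> k" "k \<le> 11"
    have "inU k [j - 1, 0]"
      using line_2[of k "j - 1"] line_80[of "j - 1"] k by (cases "k = 11") simp_all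
    then show "zp k * sp j \<in> {y. y * hecke_t \<in> hecke_U}"
      using inU_mult_t[of k "[]" j] by simp
    show "zp k * (hecke_s * alg_inverse hecke_t) \<in> {y. y * hecke_t \<in> hecke_U}"
      using base_in_U(1)[OF k, of 1] hecke_t_inverse by (simp add: mult.assoc)
    \<comment> \<open>This is \<open>s^-1 t^2\<close>, a member of the line of all
      \<open>s^-1 t^j\<close>.\<close>
    have "inU k [- 2, - 1, 0]"
      using line_1[of k 2] line_79[of "- 2"] k
      by (cases "k = 0") (simp_all add: inU_normalize)
    then show "zp k * (alg_inverse hecke_s * hecke_t) \<in> {y. y * hecke_t \<in> hecke_U}"
      using inU_mult_t[of k "[- 2]" 0] unfolding basis_words by simp
    \<comment> \<open>For \<open>s^-1 t s^-1 t\<close> four separate arguments cover the range of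
      exponents.\<close>
    have "k = 0 \<or> 1 \<le> k \<and> k \<le> 8 \<or> 9 \<le> k \<and> k \<le> 10 \<or> k = 11"
      using k by linarith
    then have "inU k [- 2, - 2, 0]"
      using line_75[of "- 2"] line_21[of k "- 2"] line_59[of k 0] line_77[of 0]
      by (elim disjE) (simp_all add: inU_normalize)
    then show "zp k * (alg_inverse hecke_s * hecke_t * alg_inverse hecke_s) \<in>
        {y. y * hecke_t \<in> hecke_U}"
      using inU_mult_t[of k "[- 2]" "- 1"] unfolding basis_words by simp
  qed
  then show "y \<in> hecke_U \<Longrightarrow> y * hecke_t \<in> hecke_U"
    by blast
qed

theorem theorem4p3p13:
  shows "(UNIV :: hecke set) = hecke_U"
proof -
  \<comment> \<open>The right multipliers preserving \<open>U\<close> form a subalgebra containing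
    \<open>s\<close> and \<open>t\<close>, hence everything; they are then applied to 1.\<close>
  let ?B = "{x. \<forall>y\<in>hecke_U. y * x \<in> hecke_U}"
  have "hecke_subalgebra ?B"
    using subspace_U unfolding hecke_subalgebra_def hecke.subspace_def
    by (simp add: distrib_left hecke_scale_mult flip: mult.assoc)
  then have B: "x \<in> ?B" for x
    by (rule hecke_generated) (simp_all add: U_mult_s U_mult_t)
  have "1 \<in> hecke_U"
    using base_in_U(1)[of 0 0] by simp
  with B have "x \<in> hecke_U" for x
    by force
  then show ?thesis
    by blast
qed

end
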